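(* Let $\mathcal L\subset\mathcal H=H((z^{-1}))$ be a (formal germ of a) Lagrangian cone satisfying the condition $(\star)$ $\mathcal L$ is a Lagrangian cone with the vertex at the origin and such that its tangent spaces $L$ are tangent to $\mathcal L$ exactly along $zL$. Let $l_0=z\frac{d}{dz}+\frac12+a(z)$, where $a(z)$ is an $\operatorname{End}(H)$-valued Laurent series in $z^{-1}$ with $a^*(-z)+a(z)=0$. Suppose the (linear) vector field $\mathbf f\mapsto l_0\mathbf f$ on $\mathcal H$ defined by the operator $l_0$ is tangent to $\mathcal L$. Then the same is true for the vector fields $\mathbf f\mapsto l_m\mathbf f$ defined by the operators $$l_m=l_0\,z\,l_0\,z\cdots z\,l_0\qquad(z\text{ repeated }m\text{ times}),\qquad m=1,2,\dots$$
   Context: Setting. $H$ is a finite-dimensional vector space over $\mathbb C$ with a non-degenerate symmetric bilinear form $(\cdot,\cdot)$; ${}^*$ denotes the adjoint with respect to this form. $\mathcal H=H((z^{-1}))$ is the space of $H$-valued Laurent series in $1/z$ (finitely many positive powers of $z$) with symplectic form $\Omega(\mathbf f,\mathbf g)=\frac1{2\pi i}\oint(\mathbf f(-z),\mathbf g(z))\,dz$; $\mathcal H_+=H[z]$ and $\mathcal H_-=z^{-1}H[[z^{-1}]]$ are complementary Lagrangian subspaces. In the formula for $l_m$, $z$ denotes the operator of multiplication by $z$. The condition on $a$ makes $l_0$ an infinitesimal symplectic transformation, and $[l_0,z]=z$. Formal Lagrangian germs. A formal germ $\mathcal L$ of a Lagrangian submanifold at a point $\mathbf f_0\in\mathcal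 H\setminus\{0\}$ means: for some Lagrangian splitting $\mathcal H=V\oplus W$ (e.g. $\mathcal H_+\oplus\mathcal H_-$, or its image under an $\operatorname{End}(H)$-valued Laurent series $M$ in $z^{-1}$ with $M^*(-z)M(z)=\mathbf 1$), $\mathcal L$ is the graph, in $\mathcal H\cong T^*V$, of the differential of a formal function on $V$ near the $V$-component of $\mathbf f_0$. For a finite-dimensional commutative local $\mathbb C$-algebra $R$ with residue field $\mathbb C$ and maximal ideal $\mathfrak m$, it has $R$-points $\mathbf f\in R\otimes\mathcal H$ (reducing to $\mathbf f_0$ modulo $\mathfrak m$), and at each of them a tangent space $T_{\mathbf f}\mathcal L\subset R\otimes\mathcal H$ (the graph of the second differential of the formal function at that point). Meaning of $(\star)$. For every such $R$ and every $R$-point $\mathbf f$ of $\mathcal L$, with $L=T_{\mathbf f}\mathcal L$: (a) $\mathbf f\in L$ (the germ is conical with vertex at $0$); (b) $zL\subset L$; (c) the set of $R$-points $\mathbf f'$ of $\mathcal L$ with $T_{\mathbf f'}\mathcal L=L$ is exactly the set of $\mathbf f'\in zL$ with $\mathbf f'\equiv\mathbf f_0$ modulo $\mathfrak m$. In particular $\mathbf f\in zL$. The vector field defined by a linear operator $A$ on $\mathcal H$ is tangent to $\mathcal L$ if $A\mathbf f\in T_{\mathbf f}\mathcal L$ for every $R$-point $\mathbf f$ of $\mathcal L$ and every $R$ ($A$ extended $R$-linearly). *)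

theory Defs
  imports
    "HOL-Analysis.Analysis"
    "HOL-Computational_Algebra.Formal_Laurent_Series"
    "HOL-Library.Multiset"
    "HOL-Library.Groups_Big_Fun"
    "HOL-Algebra.Ideal"
begin

notation fls_nth (infixl \<open>$$\<close> 75)

text \<open>
  The space \<open>H\<close> is \<open>complex^'n\<close> with an arbitrary form \<open>B\<close>. Laurent series in \<open>1/z\<close> are elements of
  the type \<open>fls\<close>, whose formal variable is read as \<open>1/z\<close>: the coefficient of \<open>z^k\<close> in \<open>f\<close> is
  \<open>f $$ (-k)\<close>.
\<close>

type_synonym 'n loop = "(complex, 'n) vec fls"

definition nondeg_sym_bilinear :: "(complex^'n \<Rightarrow> complex^'n \<Rightarrow> complex) \<Rightarrow> bool" where
  "nondeg_sym_bilinear B \<longleftrightarrow>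
     (\<forall>x. Vector_Spaces.linear (*s) (*) (B x)) \<and>
     (\<forall>x y. B x y = B y x) \<and>
     (\<forall>x. (\<forall>y. B x y = 0) \<longrightarrow> x = 0)"

definition loop_scale :: "complex \<Rightarrow> 'n::finite loop \<Rightarrow> 'n loop" where
  "loop_scale c f = Abs_fls (\<lambda>k. c *s (f $$ k))"

definition conv :: "('a::zero \<Rightarrow> 'b::zero \<Rightarrow> 'c::comm_monoid_add) \<Rightarrow> 'a fls \<Rightarrow> 'b fls \<Rightarrow> 'c fls" where
  "conv m f g =
     Abs_fls (\<lambda>n. \<Sum>i\<in>{fls_subdegree f .. n - fls_subdegree g}. m (f $$ i) (g $$ (n - i)))"

text \<open>The substitution of \<open>-z\<close> for \<open>z\<close>.\<close>

definition negz :: "'a::ab_group_add fls \<Rightarrow> 'a fls" where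
  "negz f = Abs_fls (\<lambda>k. if even k then f $$ k else - (f $$ k))"

text \<open>The contour integral is the coefficient of \<open>z^(-1)\<close>, which has index \<open>1\<close> here.\<close>

definition Omega ::
    "(complex^'n \<Rightarrow> complex^'n \<Rightarrow> complex) \<Rightarrow> 'n::finite loop \<Rightarrow> 'n loop \<Rightarrow> complex" where
  "Omega B f g = conv B (negz f) g $$ 1"

definition zmul :: "'n::finite loop \<Rightarrow> 'n loop" where
  "zmul f = fls_shift 1 f"

definition zdz :: "'n::finite loop \<Rightarrow> 'n loop" where
  "zdz f = Abs_fls (\<lambda>k. of_int (- k) *s (f $$ k))"

definition l0 :: "(complex^'n^'n) fls \<Rightarrow> 'n::finite loop \<Rightarrow> 'n loop" where
  "l0 a f = zdz f + loop_scale (1/2) f + conv (*v) a f"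

definition lm :: "(complex^'n^'n) fls \<Rightarrow> nat \<Rightarrow> 'n::finite loop \<Rightarrow> 'n loop" where
  "lm a m = ((l0 a \<circ> zmul) ^^ m) \<circ> l0 a"

definition form_adj ::
    "(complex^'n \<Rightarrow> complex^'n \<Rightarrow> complex) \<Rightarrow> complex^'n^'n \<Rightarrow> complex^'n^'n" where
  "form_adj B A = (THE A'. \<forall>x y. B (A *v x) y = B x (A' *v y))"

definition series_adj ::
    "(complex^'n \<Rightarrow> complex^'n \<Rightarrow> complex) \<Rightarrow> (complex^'n^'n) fls \<Rightarrow> (complex^'n^'n) fls" where
  "series_adj B a = Abs_fls (\<lambda>k. form_adj B (a $$ k))"

definition lagrangian ::
    "(complex^'n \<Rightarrow> complex^'n \<Rightarrow> complex) \<Rightarrow> 'n::finite loop set \<Rightarrow> bool" where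
  "lagrangian B V \<longleftrightarrow> module.subspace loop_scale V \<and> V = {f. \<forall>g\<in>V. Omega B f g = 0}"

definition lagrangian_splitting ::
    "(complex^'n \<Rightarrow> complex^'n \<Rightarrow> complex) \<Rightarrow> 'n::finite loop set \<Rightarrow> 'n loop set \<Rightarrow> bool" where
  "lagrangian_splitting B V W \<longleftrightarrow>
     lagrangian B V \<and> lagrangian B W \<and> V \<inter> W = {0} \<and> (\<forall>f. \<exists>v\<in>V. \<exists>w\<in>W. f = v + w)"

text \<open>
  A finite-dimensional algebra \<open>R\<close> over the complex numbers is given on a basis
  \<open>e\<^sub>0, \<dots>, e\<^sub>d\<^sub>-\<^sub>1\<close> (\<open>d = adim R\<close>) by structure constants, \<open>e\<^sub>i e\<^sub>j = (\<Sum>k<d. sc R i j k \<cdot> e\<^sub>k)\<close>, and by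
  the coordinates of its unit; \<open>ares R i\<close> is the value at \<open>e\<^sub>i\<close> of the residue map to the complex
  numbers. Every such algebra has this form, so one can quantify over all of them inside a formula.
  Elements of \<open>R\<close>, and of its tensor product with a space \<open>S\<close>, are coordinate sequences that vanish
  from index \<open>d\<close> on; the \<open>R\<close>-linear extension of a linear operator \<open>T\<close> is \<open>f \<mapsto> T \<circ> f\<close>.
\<close>

record fd_alg =
  adim :: nat
  sc :: "nat \<Rightarrow> nat \<Rightarrow> nat \<Rightarrow> complex"
  aunit :: "nat \<Rightarrow> complex"
  ares :: "nat \<Rightarrow> complex"

definition alg_ring :: "fd_alg \<Rightarrow> (nat \<Rightarrow> complex) ring" where
  "alg_ring R =
     \<lparr>carrier = {r. \<forall>i\<ge>adim R. r i = 0},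
      mult = (\<lambda>r s k. if k < adim R
                      then (\<Sum>i<adim R. \<Sum>j<adim R. sc R i j k * r i * s j) else 0),
      one = aunit R,
      zero = (\<lambda>_. 0),
      add = (\<lambda>r s k. r k + s k)\<rparr>"

definition residue_map :: "fd_alg \<Rightarrow> (nat \<Rightarrow> complex) \<Rightarrow> complex" where
  "residue_map R r = (\<Sum>i<adim R. ares R i * r i)"

definition max_ideal :: "fd_alg \<Rightarrow> (nat \<Rightarrow> complex) set" where
  "max_ideal R = {r \<in> carrier (alg_ring R). residue_map R r = 0}"

text \<open>
  A linear functional that maps the unit to \<open>1\<close> and whose kernel is an ideal is multiplicative, so
  the last two conditions say that \<open>R\<close> is local and that \<open>residue_map R\<close> identifies its residue
  field with the complex numbers.
\<close>

definition local_alg :: "fd_alg \<Rightarrow> bool" where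
  "local_alg R \<longleftrightarrow>
     cring (alg_ring R) \<and>
     (\<forall>I. maximalideal I (alg_ring R) \<longleftrightarrow> I = max_ideal R) \<and>
     residue_map R (aunit R) = 1"

definition tens :: "fd_alg \<Rightarrow> 'a::zero set \<Rightarrow> (nat \<Rightarrow> 'a) set" where
  "tens R S = {f. (\<forall>i<adim R. f i \<in> S) \<and> (\<forall>i\<ge>adim R. f i = 0)}"

definition const_pt :: "fd_alg \<Rightarrow> 'n::finite loop \<Rightarrow> nat \<Rightarrow> 'n loop" where
  "const_pt R f = (\<lambda>i. loop_scale (aunit R i) f)"

definition reduce :: "fd_alg \<Rightarrow> (nat \<Rightarrow> 'n::finite loop) \<Rightarrow> 'n loop" where
  "reduce R f = (\<Sum>i<adim R. loop_scale (ares R i) (f i))"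

definition Omega_ext ::
    "(complex^'n \<Rightarrow> complex^'n \<Rightarrow> complex) \<Rightarrow> fd_alg \<Rightarrow>
     (nat \<Rightarrow> 'n::finite loop) \<Rightarrow> (nat \<Rightarrow> 'n loop) \<Rightarrow> nat \<Rightarrow> complex" where
  "Omega_ext B R f g = (\<lambda>k. if k < adim R
     then (\<Sum>i<adim R. \<Sum>j<adim R. sc R i j k * Omega B (f i) (g j)) else 0)"

definition basis_prod :: "fd_alg \<Rightarrow> nat list \<Rightarrow> nat \<Rightarrow> complex" where
  "basis_prod R is =
     foldr (\<lambda>i r. (\<lambda>k. if k = i then 1 else 0) \<otimes>\<^bsub>alg_ring R\<^esub> r) is \<one>\<^bsub>alg_ring R\<^esub>"

text \<open>
  A formal function at a point \<open>v\<^sub>0\<close> of \<open>V\<close> is the family of its derivatives there, that is, of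
  symmetric \<open>k\<close>-linear forms on \<open>V\<close>, \<open>k \<ge> 0\<close>. Symmetry is built in by letting \<open>F\<close> take the
  multiset of the \<open>k\<close> arguments, so \<open>F(v\<^sub>0 + u) = (\<Sum>k. F {#u, \<dots>, u#} / k!)\<close>.
\<close>

definition formal_function :: "'n::finite loop set \<Rightarrow> ('n loop multiset \<Rightarrow> complex) \<Rightarrow> bool" where
  "formal_function V F \<longleftrightarrow>
     (\<forall>M c. \<forall>x\<in>V. \<forall>y\<in>V. set_mset M \<subseteq> V \<longrightarrow>
        F (add_mset (x + y) M) = F (add_mset x M) + F (add_mset y M) \<and>
        F (add_mset (loop_scale c x) M) = c * F (add_mset x M))"

text \<open>The \<open>R\<close>-multilinear extension of the form of degree \<open>length us\<close>.\<close>

definition form_ext ::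
    "fd_alg \<Rightarrow> ('n::finite loop multiset \<Rightarrow> complex) \<Rightarrow> (nat \<Rightarrow> 'n loop) list \<Rightarrow> nat \<Rightarrow> complex" where
  "form_ext R F us =
     (\<lambda>l. \<Sum>is\<in>{is. length is = length us \<and> set is \<subseteq> {..<adim R}}.
        basis_prod R is l * F (mset (map2 (\<lambda>u i. u i) us is)))"

text \<open>
  The derivative of order \<open>length xs\<close> at \<open>v\<^sub>0 + u\<close> in the directions \<open>xs\<close>, as a Taylor series. It is
  used for \<open>u\<close> with coefficients in the maximal ideal, which is nilpotent, so that only finitely
  many terms are non-zero.
\<close>

definition ff_deriv ::
    "fd_alg \<Rightarrow> ('n::finite loop multiset \<Rightarrow> complex) \<Rightarrow> (nat \<Rightarrow> 'n loop) \<Rightarrow>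
     (nat \<Rightarrow> 'n loop) list \<Rightarrow> nat \<Rightarrow> complex" where
  "ff_deriv R F u xs = (\<lambda>l. Sum_any (\<lambda>k. form_ext R F (replicate k u @ xs) l / fact k))"

text \<open>The base point \<open>f\<^sub>0\<close> of a germ is stored through its components in \<open>V\<close> and \<open>W\<close>.\<close>

record 'n germ =
  gV :: "(complex, 'n) vec fls set"
  gW :: "(complex, 'n) vec fls set"
  gv0 :: "(complex, 'n) vec fls"
  gw0 :: "(complex, 'n) vec fls"
  gF :: "(complex, 'n) vec fls multiset \<Rightarrow> complex"

definition base_pt :: "'n::finite germ \<Rightarrow> 'n loop" where
  "base_pt \<L> = gv0 \<L> + gw0 \<L>"

text \<open>
  \<open>W\<close> is identified with a space of functionals on \<open>V\<close> by \<open>w \<mapsto> Omega B w\<close>. For \<open>V = H[z]\<close> this is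
  the whole algebraic dual; in general the differential of \<open>F\<close> is required to take values in \<open>W\<close>,
  so that its graph is a subset of \<open>V \<oplus> W\<close>.
\<close>

definition lagrangian_germ ::
    "(complex^'n \<Rightarrow> complex^'n \<Rightarrow> complex) \<Rightarrow> 'n::finite germ \<Rightarrow> bool" where
  "lagrangian_germ B \<L> \<longleftrightarrow>
     lagrangian_splitting B (gV \<L>) (gW \<L>) \<and>
     gv0 \<L> \<in> gV \<L> \<and> gw0 \<L> \<in> gW \<L> \<and> base_pt \<L> \<noteq> 0 \<and>
     formal_function (gV \<L>) (gF \<L>) \<and>
     (\<forall>M. set_mset M \<subseteq> gV \<L> \<longrightarrow>
        (\<exists>w\<in>gW \<L>. \<forall>x\<in>gV \<L>. gF \<L> (add_mset x M) = Omega B w x)) \<and>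
     (\<forall>x\<in>gV \<L>. gF \<L> {#x#} = Omega B (gw0 \<L>) x)"

definition on_graph ::
    "(complex^'n \<Rightarrow> complex^'n \<Rightarrow> complex) \<Rightarrow> 'n::finite germ \<Rightarrow> fd_alg \<Rightarrow>
     (nat \<Rightarrow> 'n loop) \<Rightarrow> (nat \<Rightarrow> 'n loop) \<Rightarrow> bool" where
  "on_graph B \<L> R v w \<longleftrightarrow>
     v \<in> tens R (gV \<L>) \<and> w \<in> tens R (gW \<L>) \<and>
     reduce R v = gv0 \<L> \<and> reduce R w = gw0 \<L> \<and>
     (\<forall>x\<in>tens R (gV \<L>). Omega_ext B R w x = ff_deriv R (gF \<L>) (\<lambda>i. v i - const_pt R (gv0 \<L>) i) [x])"

definition points ::
    "(complex^'n \<Rightarrow> complex^'n \<Rightarrow> complex) \<Rightarrow> 'n::finite germ \<Rightarrow> fd_alg \<Rightarrow> (nat \<Rightarrow> 'n loop) set" where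
  "points B \<L> R = {(\<lambda>i. v i + w i) | v w. on_graph B \<L> R v w}"

definition tangent_space ::
    "(complex^'n \<Rightarrow> complex^'n \<Rightarrow> complex) \<Rightarrow> 'n::finite germ \<Rightarrow> fd_alg \<Rightarrow>
     (nat \<Rightarrow> 'n loop) \<Rightarrow> (nat \<Rightarrow> 'n loop) set" where
  "tangent_space B \<L> R f =
     {(\<lambda>i. x i + y i) | x y v w. on_graph B \<L> R v w \<and> f = (\<lambda>i. v i + w i) \<and>
        x \<in> tens R (gV \<L>) \<and> y \<in> tens R (gW \<L>) \<and>
        (\<forall>x'\<in>tens R (gV \<L>).
           Omega_ext B R y x' = ff_deriv R (gF \<L>) (\<lambda>i. v i - const_pt R (gv0 \<L>) i) [x, x'])}"

definition cone_condition ::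
    "(complex^'n \<Rightarrow> complex^'n \<Rightarrow> complex) \<Rightarrow> 'n::finite germ \<Rightarrow> bool" where
  "cone_condition B \<L> \<longleftrightarrow>
     (\<forall>R f. local_alg R \<longrightarrow> f \<in> points B \<L> R \<longrightarrow>
        (let L = tangent_space B \<L> R f; zL = (\<lambda>g. zmul \<circ> g) ` L in
           f \<in> L \<and> zL \<subseteq> L \<and>
           {f' \<in> points B \<L> R. tangent_space B \<L> R f' = L} =
             {f' \<in> zL. reduce R f' = base_pt \<L>}))"

definition tangent_to ::
    "(complex^'n \<Rightarrow> complex^'n \<Rightarrow> complex) \<Rightarrow> ('n loop \<Rightarrow> 'n loop) \<Rightarrow> 'n::finite germ \<Rightarrow> bool" where
  "tangent_to B T \<L> \<longleftrightarrow>
     (\<forall>R f. local_alg R \<longrightarrow> f \<in> points B \<L> R \<longrightarrow> T \<circ> f \<in> tangent_space B \<L> R f)"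

text \<open>The functions passed to \<open>Abs_fls\<close> above are Laurent series.\<close>

lemma loop_scale_nth [simp]: "loop_scale c f $$ k = c *s (f $$ k)"
proof -
  obtain N where "\<forall>n<N. f $$ n = 0" by (elim fls_nth_vanishes_belowE)
  then show ?thesis
    unfolding loop_scale_def by (intro nth_Abs_fls_lower_bound[of N]) auto
qed

lemma conv_nth:
  "conv m f g $$ n = (\<Sum>i\<in>{fls_subdegree f .. n - fls_subdegree g}. m (f $$ i) (g $$ (n - i)))"
  unfolding conv_def
  by (rule nth_Abs_fls_lower_bound[of "fls_subdegree f + fls_subdegree g"]) auto

lemma negz_nth [simp]: "negz f $$ k = (if even k then f $$ k else - (f $$ k))"
proof -
  obtain N where "\<forall>n<N. f $$ n = 0" by (elim fls_nth_vanishes_belowE)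
  then show ?thesis
    unfolding negz_def by (intro nth_Abs_fls_lower_bound[of N]) auto
qed

lemma zmul_nth [simp]: "zmul f $$ k = f $$ (k + 1)"
  by (simp add: zmul_def)

lemma zdz_nth [simp]: "zdz f $$ k = of_int (- k) *s (f $$ k)"
proof -
  obtain N where "\<forall>n<N. f $$ n = 0" by (elim fls_nth_vanishes_belowE)
  then show ?thesis
    unfolding zdz_def by (intro nth_Abs_fls_lower_bound[of N]) auto
qed

lemma form_adj_zero:
  assumes "nondeg_sym_bilinear B"
  shows "form_adj B 0 = 0"
proof -
  have lin: "Vector_Spaces.linear (*s) (*) (B x)" and sym: "B x y = B y x"
    and nd: "(\<And>y. B x y = 0) \<Longrightarrow> x = 0" for x y
    using assms unfolding nondeg_sym_bilinear_def by auto
  have B0: "B x 0 = 0" for x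
  proof -
    interpret Vector_Spaces.linear "(*s)" "(*)" "B x" by (rule lin)
    show ?thesis by (rule zero)
  qed
  show ?thesis
    unfolding form_adj_def
  proof (rule the_equality)
    show "\<forall>x y. B (0 *v x) y = B x (0 *v y)"
      using B0 sym by simp
  next
    fix A' :: "complex^'a^'a"
    assume *: "\<forall>x y. B (0 *v x) y = B x (A' *v y)"
    have "A' *v y = 0" for y
      by (rule nd) (metis * B0 sym matrix_vector_mult_0)
    then show "A' = 0"
      by (simp add: matrix_eq)
  qed
qed

lemma series_adj_nth:
  assumes "nondeg_sym_bilinear B"
  shows "series_adj B a $$ k = form_adj B (a $$ k)"
proof -
  obtain N where "\<forall>n<N. a $$ n = 0" by (elim fls_nth_vanishes_belowE)
  then show ?thesis
    unfolding series_adj_def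
    by (intro nth_Abs_fls_lower_bound[of N]) (auto simp: form_adj_zero[OF assms])
qed

lemma vector_space_loop_scale: "vector_space loop_scale"
  by unfold_locales (auto intro!: fls_eqI simp: vec_eq_iff algebra_simps)

end

theory Submission
  imports Defs "HOL-Algebra.QuotRing" "HOL-Library.Function_Algebras"
begin

text \<open>
  Let \<open>L\<close> be the tangent space at an \<open>R\<close>-point \<open>f\<close>. The key is that \<open>l\<^sub>0 z L \<subseteq> L\<close>; then
  \<open>l\<^sub>0 f \<in> L\<close> gives \<open>l\<^sub>m f = (l\<^sub>0 z)\<^sup>m l\<^sub>0 f \<in> L\<close>. Write \<open>f = z f'\<close> with \<open>f' \<in> L\<close> and let \<open>h \<in> L\<close>.
  Over the dual numbers \<open>R[\<epsilon>]\<close> the element \<open>z (f' + \<epsilon> h)\<close> reduces to the base point and lies in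
  \<open>z L[\<epsilon>]\<close>, where \<open>L[\<epsilon>]\<close> is the tangent space at \<open>f\<close>, so it is a point with tangent space
  \<open>L[\<epsilon>]\<close>. Tangency of \<open>l\<^sub>0\<close> at this point has \<open>\<epsilon>\<close>-component \<open>l\<^sub>0 z h \<in> L\<close>.

  That the tangent space over \<open>R[\<epsilon>]\<close> is \<open>L \<oplus> \<epsilon> L\<close> uses that Taylor series are finite, that is,
  that the maximal ideal of \<open>R\<close> is nilpotent.
\<close>

section \<open>Local algebras\<close>

lemma (in cring) nonunit_in_maximalideal:
  assumes x: "x \<in> carrier R" "x \<notin> Units R"
  shows "\<exists>M. maximalideal M R \<and> x \<in> M"
proof -
  \<comment> \<open>Zorn's lemma is applied to the ideals containing \<open>x\<close> but not
    \<open>\<one>\<close>. Missing \<open>\<one>\<close> is the form of properness that survives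
    unions of chains.\<close>
  define P where "P = {I. ideal I R \<and> x \<in> I \<and> \<one> \<notin> I}"
  have "\<one> \<notin> PIdl x"
    using x by (auto simp: cgenideal_def Units_def m_comm)
  then have "PIdl x \<in> P"
    using x by (simp add: P_def cgenideal_ideal cgenideal_self)
  then have "P \<noteq> {}" by blast
  moreover have "\<Union>C \<in> P" if C: "C \<noteq> {}" "subset.chain P C" for C
  proof -
    have id: "ideal I R" if "I \<in> C" for I
      using C that by (auto simp: P_def subset.chain_def)
    have add: "u \<oplus> v \<in> \<Union>C" if uv: "u \<in> \<Union>C" "v \<in> \<Union>C" for u v
    proof -
      obtain I J where IJ: "I \<in> C" "J \<in> C" "u \<in> I" "v \<in> J" using uv by blast
      then have "I \<subseteq> J \<or> J \<subseteq> I"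
        using C(2) by (auto simp: subset.chain_def)
      then obtain K where K: "K \<in> C" "u \<in> K" "v \<in> K" using IJ by blast
      interpret K: ideal K R by (rule id[OF K(1)])
      show ?thesis using K K.a_closed by blast
    qed
    have "ideal (\<Union>C) R"
    proof (rule idealI[OF ring_axioms])
      show "subgroup (\<Union>C) (add_monoid R)"
      proof (rule add.subgroupI)
        show "\<Union>C \<subseteq> carrier R" using ideal.Icarr[OF id] by blast
        show "\<Union>C \<noteq> {}"
          using C(1) additive_subgroup.zero_closed[OF ideal.axioms(1)[OF id]] by blast
        show "\<ominus> u \<in> \<Union>C" if "u \<in> \<Union>C" for u
          using that additive_subgroup.a_inv_closed[OF ideal.axioms(1)[OF id]] by blast
        show "u \<oplus> v \<in> \<Union>C" if "u \<in> \<Union>C" "v \<in> \<Union>C" for u v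
          using add[OF that] .
      qed
    next
      show "u \<otimes> v \<in> \<Union>C" if "v \<in> \<Union>C" "u \<in> carrier R" for u v
        using that ideal.I_l_closed[OF id] by blast
      show "v \<otimes> u \<in> \<Union>C" if "v \<in> \<Union>C" "u \<in> carrier R" for u v
        using that ideal.I_r_closed[OF id] by blast
    qed
    then show ?thesis
      using C by (auto simp: P_def subset.chain_def)
  qed
  ultimately obtain M where M: "M \<in> P" "\<And>X. X \<in> P \<Longrightarrow> M \<subseteq> X \<Longrightarrow> X = M"
    using subset_Zorn_nonempty[of P] by auto
  have "maximalideal M R"
  proof (rule maximalidealI)
    fix J assume J: "ideal J R" "M \<subseteq> J"
    then show "J = M \<or> J = carrier R"
      using M ideal.one_imp_carrier[OF J(1)] by (auto simp: P_def)
  qed (use M in \<open>auto simp: P_def\<close>)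
  then show ?thesis using M by (auto simp: P_def)
qed

text \<open>A proper ideal contains no unit, so it lies inside \<open>M\<close>. This is the
  criterion by which \<open>R[\<epsilon>]\<close> is shown to be local.\<close>

lemma (in cring) maximalideal_unique_iff:
  assumes M: "ideal M R" "\<one> \<notin> M" and units: "carrier R - M \<subseteq> Units R"
  shows "maximalideal I R \<longleftrightarrow> I = M"
proof -
  have sub: "J \<subseteq> M" if J: "ideal J R" "J \<noteq> carrier R" for J
  proof
    fix x assume "x \<in> J"
    then have "x \<notin> Units R"
      using J Units_l_inv_ex ideal.I_l_closed ideal.one_imp_carrier by metis
    then show "x \<in> M"
      using units \<open>x \<in> J\<close> ideal.Icarr[OF J(1)] by blast
  qed
  have "maximalideal M R"
    using M sub by (intro maximalidealI) auto
  moreover have "I = M" if "maximalideal I R"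
  proof -
    interpret I: maximalideal I R by fact
    show ?thesis
      using I.I_maximal[OF M(1)] sub[OF I.is_ideal] I.I_notcarr M ideal.Icarr[OF M(1)] by blast
  qed
  ultimately show ?thesis by blast
qed

section \<open>Linear dependence of coordinate sequences\<close>

lemma sum_apply: "(\<Sum>i\<in>A. f i) k = (\<Sum>i\<in>A. f i k)"
  by (induction A rule: infinite_finite_induct) auto

interpretation fun_vs: vector_space "\<lambda>(c::complex) (r::nat \<Rightarrow> complex) i. c * r i"
  by unfold_locales (auto simp: fun_eq_iff algebra_simps)

text \<open>Otherwise \<open>p d, ..., p 0\<close>, added in this order, would be
  \<open>d + 1\<close> independent vectors in a space of dimension \<open>d\<close>. The span is
  over later indices because later partial products are multiples of earlier ones.\<close>

lemma exists_mem_span_later: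
  fixes p :: "nat \<Rightarrow> nat \<Rightarrow> complex"
  assumes supp: "\<And>j i. i \<ge> d \<Longrightarrow> p j i = 0"
  shows "\<exists>s\<le>d. p s \<in> fun_vs.span (p ` {s<..d})"
proof (rule ccontr)
  assume neg: "\<not> ?thesis"
  \<comment> \<open>The last \<open>n\<close> vectors are treated, starting from the empty set at
    \<open>n = 0\<close>. The cardinality rules out repetitions, which independence of an image set
    does not see.\<close>
  have "fun_vs.independent (p ` {Suc d - n..d}) \<and> card (p ` {Suc d - n..d}) = n" if "n \<le> Suc d" for n
    using that
  proof (induction n)
    case 0
    then show ?case by (simp add: fun_vs.dependent_def)
  next
    case (Suc n)
    define s where "s = d - n"
    have s: "s \<le> d" "{Suc d - Suc n..d} = insert s {s<..d}" "{Suc d - n..d} = {s<..d}"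
      using Suc.prems by (auto simp: s_def)
    have "p s \<notin> fun_vs.span (p ` {s<..d})" using neg s by blast
    moreover from this have "p s \<notin> p ` {s<..d}" using fun_vs.span_base by blast
    ultimately show ?case
      using Suc s fun_vs.independent_insertI[of "p s" "p ` {s<..d}"]
      by (simp add: card_insert_disjoint)
  qed
  from this[of "Suc d"] have ind: "fun_vs.independent (p ` {..d})" "card (p ` {..d}) = Suc d"
    by (simp_all add: atMost_atLeast0)
  define e :: "nat \<Rightarrow> nat \<Rightarrow> complex" where "e = (\<lambda>i k. if k = i then 1 else 0)"
  have "p j \<in> fun_vs.span (e ` {..<d})" for j
  proof -
    have "p j = (\<Sum>i<d. (\<lambda>k. p j i * e i k))"
      using supp by (auto simp: fun_eq_iff e_def sum_apply if_distrib cong: if_cong)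
    also have "\<dots> \<in> fun_vs.span (e ` {..<d})"
      by (intro fun_vs.span_sum fun_vs.span_scale fun_vs.span_base) auto
    finally show ?thesis .
  qed
  then have "card (p ` {..d}) \<le> card (e ` {..<d})"
    using fun_vs.independent_span_bound[of "e ` {..<d}" "p ` {..d}"] ind(1) by auto
  also have "\<dots> \<le> d" using card_image_le[of "{..<d}" e] by simp
  finally show False using ind(2) by simp
qed

section \<open>Arithmetic in coordinates and nilpotency of the maximal ideal\<close>

abbreviation alg_mult :: "fd_alg \<Rightarrow> (nat \<Rightarrow> complex) \<Rightarrow> (nat \<Rightarrow> complex) \<Rightarrow> nat \<Rightarrow> complex" where
  "alg_mult R r s \<equiv> r \<otimes>\<^bsub>alg_ring R\<^esub> s"

definition alg_basis :: "nat \<Rightarrow> nat \<Rightarrow> complex" where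
  "alg_basis i = (\<lambda>k. if k = i then 1 else 0)"

lemma alg_carrier_iff: "r \<in> carrier (alg_ring R) \<longleftrightarrow> (\<forall>i\<ge>adim R. r i = 0)"
  by (simp add: alg_ring_def)

lemma alg_ring_ops [simp]:
  "\<one>\<^bsub>alg_ring R\<^esub> = aunit R"
  "\<zero>\<^bsub>alg_ring R\<^esub> = (\<lambda>_. 0)"
  "r \<oplus>\<^bsub>alg_ring R\<^esub> s = (\<lambda>k. r k + s k)"
  by (simp_all add: alg_ring_def)

lemma alg_mult_nth:
  "alg_mult R r s k = (if k < adim R then \<Sum>i<adim R. \<Sum>j<adim R. sc R i j k * r i * s j else 0)"
  by (simp add: alg_ring_def)

lemma alg_mult_closed: "alg_mult R r s \<in> carrier (alg_ring R)"
  by (simp add: alg_carrier_iff alg_mult_nth)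

lemma alg_basis_closed: "i < adim R \<Longrightarrow> alg_basis i \<in> carrier (alg_ring R)"
  by (auto simp: alg_carrier_iff alg_basis_def)

lemma alg_mult_add_left: "alg_mult R (\<lambda>k. r k + s k) t = (\<lambda>k. alg_mult R r t k + alg_mult R s t k)"
  by (simp add: fun_eq_iff alg_mult_nth algebra_simps sum.distrib)

lemma alg_mult_add_right: "alg_mult R t (\<lambda>k. r k + s k) = (\<lambda>k. alg_mult R t r k + alg_mult R t s k)"
  by (simp add: fun_eq_iff alg_mult_nth algebra_simps sum.distrib)

lemma alg_mult_scale_left: "alg_mult R (\<lambda>k. c * r k) t = (\<lambda>k. c * alg_mult R r t k)"
  by (simp add: fun_eq_iff alg_mult_nth algebra_simps sum_distrib_left)

lemma alg_mult_scale_right: "alg_mult R t (\<lambda>k. c * r k) = (\<lambda>k. c * alg_mult R t r k)"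
  by (simp add: fun_eq_iff alg_mult_nth algebra_simps sum_distrib_left)

lemma alg_mult_zero: "alg_mult R (\<lambda>_. 0) t = (\<lambda>_. 0)" "alg_mult R t (\<lambda>_. 0) = (\<lambda>_. 0)"
  by (simp_all add: fun_eq_iff alg_mult_nth)

lemma residue_map_linear:
  "residue_map R (\<lambda>k. r k + s k) = residue_map R r + residue_map R s"
  "residue_map R (\<lambda>k. c * r k) = c * residue_map R r"
  by (simp_all add: residue_map_def algebra_simps sum.distrib sum_distrib_left)

lemma residue_map_basis: "i < adim R \<Longrightarrow> residue_map R (alg_basis i) = ares R i"
  by (simp add: residue_map_def alg_basis_def if_distrib cong: if_cong)

lemma local_algD:
  assumes "local_alg R"
  shows "cring (alg_ring R)" "maximalideal I (alg_ring R) \<longleftrightarrow> I = max_ideal R"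
    "residue_map R (aunit R) = 1"
  using assms unfolding local_alg_def by blast+

lemma max_ideal_scale: "r \<in> max_ideal R \<Longrightarrow> (\<lambda>k. c * r k) \<in> max_ideal R"
  by (simp add: max_ideal_def alg_carrier_iff residue_map_linear)

text \<open>The initial factor \<open>p\<close> is a parameter so that the first factor of the
  sequence can be absorbed into it, as an induction from the left requires.\<close>

primrec alg_prod :: "fd_alg \<Rightarrow> (nat \<Rightarrow> complex) \<Rightarrow> (nat \<Rightarrow> nat \<Rightarrow> complex) \<Rightarrow> nat \<Rightarrow> nat \<Rightarrow> complex" where
  "alg_prod R p y 0 = p"
| "alg_prod R p y (Suc k) = alg_mult R (alg_prod R p y k) (y k)"

lemma alg_prod_Suc_left: "alg_prod R p (case_nat x y) (Suc k) = alg_prod R (alg_mult R p x) y k"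
  by (induction k) auto

locale local_algebra =
  fixes R :: fd_alg
  assumes local: "local_alg R"
begin

sublocale cring "alg_ring R"
  by (rule local_algD(1)[OF local])

sublocale max_ideal: maximalideal "max_ideal R" "alg_ring R"
  using local_algD(2)[OF local] by blast

lemma residue_one: "residue_map R (aunit R) = 1"
  by (rule local_algD(3)[OF local])

lemma unit_closed: "aunit R \<in> carrier (alg_ring R)"
  using one_closed by simp

text \<open>A non-unit lies in some maximal ideal, and by locality the only one is the kernel of the
  residue map.\<close>

lemma exists_inverse:
  assumes "x \<in> carrier (alg_ring R)" "residue_map R x \<noteq> 0"
  shows "\<exists>y\<in>carrier (alg_ring R). alg_mult R x y = aunit R"
proof -
  have "x \<notin> max_ideal R" using assms unfolding max_ideal_def by blast
  then have "x \<in> Units (alg_ring R)"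
    using nonunit_in_maximalideal[of x] assms local_algD(2)[OF local] by blast
  from Units_r_inv_ex[OF this] show ?thesis unfolding alg_ring_ops .
qed

text \<open>Nakayama's argument for a principal ideal: \<open>p (1 - r) = 0\<close>, and
  \<open>1 - r\<close> has residue 1, so it is invertible.\<close>

lemma eq_zero_if_in_multiple:
  assumes p: "p \<in> carrier (alg_ring R)" and r: "r \<in> max_ideal R" and eq: "p = alg_mult R p r"
  shows "p = (\<lambda>_. 0)"
proof -
  have rc: "r \<in> carrier (alg_ring R)" "residue_map R r = 0" using r unfolding max_ideal_def by blast+
  define q where "q = (\<lambda>k. aunit R k + (-1) * r k)"
  have "q \<in> carrier (alg_ring R)"
    using rc unit_closed unfolding q_def alg_carrier_iff by simp
  moreover have "residue_map R q = 1"
    unfolding q_def residue_map_linear using rc residue_one by simp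
  ultimately obtain t where t: "t \<in> carrier (alg_ring R)" "alg_mult R q t = aunit R"
    using exists_inverse[of q] by (metis zero_neq_one)
  have "alg_mult R p q = (\<lambda>k. p k + (-1) * alg_mult R p r k)"
    unfolding q_def alg_mult_add_right alg_mult_scale_right using r_one[OF p] by simp
  also have "\<dots> = (\<lambda>_. 0)" using eq by (simp add: fun_eq_iff)
  finally have "alg_mult R p q = (\<lambda>_. 0)" .
  then have "alg_mult R (alg_mult R p q) t = (\<lambda>_. 0)" by (simp add: alg_mult_zero)
  then show ?thesis
    using m_assoc[OF p \<open>q \<in> _\<close> t(1)] t r_one[OF p] by simp
qed

text \<open>Nilpotency of the maximal ideal: the \<open>d + 1\<close> partial products of \<open>d\<close> factors are linearly
  dependent, so one of them is a multiple of itself by an element of the maximal ideal.\<close>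

lemma max_ideal_prod_eq_zero:
  assumes y: "\<And>j. y j \<in> max_ideal R" and k: "k \<ge> adim R"
  shows "alg_prod R (aunit R) y k = (\<lambda>_. 0)"
proof -
  define p where "p = alg_prod R (aunit R) y"
  have p_Suc: "p (Suc j) = alg_mult R (p j) (y j)" for j by (simp add: p_def)
  have pc: "p j \<in> carrier (alg_ring R)" for j
    by (cases j) (auto simp: p_def alg_mult_closed unit_closed)
  have yc: "y j \<in> carrier (alg_ring R)" for j using y max_ideal.Icarr by blast
  obtain s where s: "s \<le> adim R" "p s \<in> fun_vs.span (p ` {s<..adim R})"
    using exists_mem_span_later[of "adim R" p] pc by (auto simp: alg_carrier_iff)
  \<comment> \<open>For \<open>j > s\<close> the product \<open>p j\<close> is \<open>p s\<close>
    times \<open>y s \<cdots> y (j - 1)\<close>, a non-empty product of elements of the maximal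
    ideal.\<close>
  have later: "p j \<in> alg_mult R (p s) ` max_ideal R" if "s < j" for j
    using that
  proof (induction j)
    case (Suc j)
    show ?case
    proof (cases "s = j")
      case True
      then show ?thesis using y p_Suc by auto
    next
      case False
      then obtain r where r: "r \<in> max_ideal R" "p j = alg_mult R (p s) r" using Suc by auto
      then have "p (Suc j) = alg_mult R (p s) (alg_mult R r (y j))"
        using m_assoc pc yc max_ideal.Icarr by (simp add: p_Suc)
      then show ?thesis using r max_ideal.I_r_closed yc by auto
    qed
  qed simp
  \<comment> \<open>\<open>S\<close> is a linear subspace containing all later products, hence also
    their span and with it \<open>p s\<close>; so \<open>p s\<close> is a multiple of itself by an
    element of the maximal ideal.\<close>
  define S where "S = alg_mult R (p s) ` max_ideal R"
  have zero: "0 \<in> S"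
    using imageI[OF max_ideal.zero_closed, of "alg_mult R (p s)"]
    by (simp add: S_def alg_mult_zero zero_fun_def)
  have add: "u + v \<in> S" if uv: "u \<in> S" "v \<in> S" for u v
  proof -
    obtain r t where rt: "r \<in> max_ideal R" "u = alg_mult R (p s) r"
      "t \<in> max_ideal R" "v = alg_mult R (p s) t"
      using uv unfolding S_def by blast
    then have "(\<lambda>k. r k + t k) \<in> max_ideal R"
      using max_ideal.a_closed[of r t] by simp
    moreover have "u + v = alg_mult R (p s) (\<lambda>k. r k + t k)"
      using rt by (simp add: alg_mult_add_right plus_fun_def)
    ultimately show ?thesis unfolding S_def by blast
  qed
  have scale: "(\<lambda>i. c * u i) \<in> S" if u: "u \<in> S" for c u
  proof -
    obtain r where r: "r \<in> max_ideal R" "u = alg_mult R (p s) r" using u unfolding S_def by blast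
    have "(\<lambda>i. c * u i) = alg_mult R (p s) (\<lambda>k. c * r k)"
      unfolding r(2) by (rule alg_mult_scale_right[symmetric])
    then show ?thesis unfolding S_def using max_ideal_scale[OF r(1)] by blast
  qed
  have "fun_vs.subspace S"
    unfolding fun_vs.subspace_def using zero add scale by blast
  then have "fun_vs.span (p ` {s<..adim R}) \<subseteq> S"
    using later unfolding S_def by (intro fun_vs.span_minimal) auto
  then have "p s \<in> alg_mult R (p s) ` max_ideal R" using s unfolding S_def by blast
  then have "p s = (\<lambda>_. 0)" using eq_zero_if_in_multiple[OF pc] by blast
  then have "p (s + n) = (\<lambda>_. 0)" for n
    by (induction n) (auto simp: p_Suc alg_mult_zero)
  from this[of "k - s"] show ?thesis using s k by (simp add: p_def)
qed

end

section \<open>Multilinear forms over an algebra\<close>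

interpretation loop: vector_space loop_scale
  by (rule vector_space_loop_scale)

text \<open>Recursive version of \<open>form_ext\<close>: \<open>p\<close> accumulates the product
  of the basis elements chosen so far, \<open>M\<close> the corresponding arguments of
  \<open>F\<close>. Both must be general for inductions over the list of vectors.\<close>

fun form_rec ::
    "fd_alg \<Rightarrow> ('n::finite loop multiset \<Rightarrow> complex) \<Rightarrow> (nat \<Rightarrow> complex) \<Rightarrow> (nat \<Rightarrow> 'n loop) list \<Rightarrow>
     'n loop multiset \<Rightarrow> nat \<Rightarrow> complex" where
  "form_rec R F p [] M l = p l * F M"
| "form_rec R F p (u # us) M l =
     (\<Sum>i<adim R. form_rec R F (alg_mult R p (alg_basis i)) us (add_mset (u i) M) l)"

lemma form_rec_linear:
  "form_rec R F (\<lambda>k. p k + c * q k) us M l = form_rec R F p us M l + c * form_rec R F q us M l"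
  by (induction us arbitrary: p q M)
    (simp_all add: algebra_simps alg_mult_add_left alg_mult_scale_left sum.distrib sum_distrib_left)

lemma form_rec_zero [simp]: "form_rec R F (\<lambda>_. 0) us M l = 0"
  by (induction us arbitrary: M) (simp_all add: alg_mult_zero)

lemma basis_prod_Nil: "basis_prod R [] = aunit R"
  by (simp add: basis_prod_def)

lemma basis_prod_Cons: "basis_prod R (i # is) = alg_mult R (alg_basis i) (basis_prod R is)"
  by (simp add: basis_prod_def alg_basis_def)

context local_algebra
begin

lemma basis_prod_closed: "basis_prod R is \<in> carrier (alg_ring R)"
  by (cases "is") (simp_all add: basis_prod_Nil basis_prod_Cons unit_closed alg_mult_closed)

text \<open>Unrolls the recursion: \<open>is\<close> lists the basis element chosen for each
  argument. \<open>basis_prod\<close> brackets to the right and the accumulator to the left, so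
  associativity in the carrier is needed.\<close>

lemma form_rec_eq_sum:
  assumes "p \<in> carrier (alg_ring R)"
  shows "form_rec R F p us M l =
    (\<Sum>is\<in>{is. length is = length us \<and> set is \<subseteq> {..<adim R}}.
        alg_mult R p (basis_prod R is) l * F (mset (map2 (\<lambda>u i. u i) us is) + M))"
  using assms
proof (induction us arbitrary: p M)
  case Nil
  have "{is. length is = length [] \<and> set is \<subseteq> {..<adim R}} = {[]}" by auto
  then show ?case using r_one[OF Nil] by (simp add: basis_prod_Nil)
next
  case (Cons u us)
  define S where "S = (\<lambda>n. {is. length is = n \<and> set is \<subseteq> {..<adim R}})"
  \<comment> \<open>A list of length \<open>n + 1\<close> is its tail paired with its head, which
    turns the double sum into a single one.\<close>
  have S_Suc: "S (length (u # us)) = (\<lambda>(is, i). i # is) ` (S (length us) \<times> {..<adim R})"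
    using lists_length_Suc_eq[of "{..<adim R}" "length us"] by (simp add: S_def conj_commute)
  have inj: "inj_on (\<lambda>(is, i). i # is) (S (length us) \<times> {..<adim R})"
    by (auto simp: inj_on_def)
  let ?g = "\<lambda>us M p is. alg_mult R p (basis_prod R is) l * F (mset (map2 (\<lambda>u i. u i) us is) + M)"
  have "form_rec R F p (u # us) M l =
      (\<Sum>i<adim R. \<Sum>is\<in>S (length us). ?g us (add_mset (u i) M) (alg_mult R p (alg_basis i)) is)"
    using Cons.IH[OF alg_mult_closed] by (simp add: S_def)
  also have "\<dots> = (\<Sum>i<adim R. \<Sum>is\<in>S (length us). ?g (u # us) M p (i # is))"
  proof (intro sum.cong refl)
    fix i "is" assume "i \<in> {..<adim R}" "is \<in> S (length us)"
    then show "?g us (add_mset (u i) M) (alg_mult R p (alg_basis i)) is = ?g (u # us) M p (i # is)"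
      using m_assoc[OF Cons.prems alg_basis_closed basis_prod_closed] by (simp add: basis_prod_Cons)
  qed
  also have "\<dots> = (\<Sum>is\<in>S (length (u # us)). ?g (u # us) M p is)"
    unfolding S_Suc
    by (subst sum.reindex[OF inj], subst sum.swap) (simp add: sum.cartesian_product o_def case_prod_unfold)
  finally show ?case unfolding S_def .
qed

lemma form_ext_eq_rec: "form_ext R F us l = form_rec R F (aunit R) us {#} l"
proof -
  have "alg_mult R (aunit R) (basis_prod R is) = basis_prod R is" for "is"
    using l_one[OF basis_prod_closed] by simp
  then show ?thesis
    by (simp add: form_rec_eq_sum[OF unit_closed] form_ext_def)
qed

end

section \<open>Multilinearity of formal functions and finiteness of their Taylor series\<close>

lemma formal_functionD:
  assumes "formal_function V F" "x \<in> V" "y \<in> V" "set_mset M \<subseteq> V"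
  shows "F (add_mset (x + y) M) = F (add_mset x M) + F (add_mset y M)"
    "F (add_mset (loop_scale c x) M) = c * F (add_mset x M)"
  using assms unfolding formal_function_def by blast+

lemma formal_function_zero:
  assumes "formal_function V F" "0 \<in> V" "set_mset M \<subseteq> V"
  shows "F (add_mset 0 M) = 0"
  using formal_functionD(2)[OF assms(1,2,2,3), of 0] by simp

lemma formal_function_sum:
  assumes F: "formal_function V F" and V: "loop.subspace V"
    and M: "set_mset M \<subseteq> V" and v: "\<And>i. i \<in> I \<Longrightarrow> v i \<in> V" and "finite I"
  shows "F (add_mset (\<Sum>i\<in>I. loop_scale (c i) (v i)) M) = (\<Sum>i\<in>I. c i * F (add_mset (v i) M))"
  using \<open>finite I\<close> v
proof (induction I)
  case empty
  then show ?case using formal_function_zero[OF F loop.subspace_0[OF V] M] by simp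
next
  case (insert i I)
  have "(\<Sum>i\<in>I. loop_scale (c i) (v i)) \<in> V"
    using insert.prems by (intro loop.subspace_sum[OF V] loop.subspace_scale[OF V]) auto
  moreover have "loop_scale (c i) (v i) \<in> V"
    using insert.prems by (intro loop.subspace_scale[OF V]) auto
  ultimately show ?case
    using insert formal_functionD[OF F _ _ M] by simp
qed

text \<open>The arguments already collected in the multiset still enter linearly. With coefficients
  \<open>ares R i\<close> this assembles \<open>reduce R u\<close> inside \<open>F\<close>.\<close>

lemma form_rec_mset_sum:
  assumes F: "formal_function V F" and V: "loop.subspace V"
    and M: "set_mset M \<subseteq> V" and v: "\<And>i. i \<in> I \<Longrightarrow> v i \<in> V" and I: "finite I"
    and us: "set us \<subseteq> tens R V"
  shows "form_rec R F p us (add_mset (\<Sum>i\<in>I. loop_scale (c i) (v i)) M) l =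
    (\<Sum>i\<in>I. c i * form_rec R F p us (add_mset (v i) M) l)"
  using M us
proof (induction us arbitrary: p M)
  case Nil
  then show ?case
    using formal_function_sum[OF F V _ v I] by (simp add: sum_distrib_left mult_ac)
next
  case (Cons u us)
  have "form_rec R F p' us (add_mset (u j) (add_mset (\<Sum>i\<in>I. loop_scale (c i) (v i)) M)) l =
      (\<Sum>i\<in>I. c i * form_rec R F p' us (add_mset (u j) (add_mset (v i) M)) l)"
    if "j < adim R" for j p'
    using Cons.IH[of "add_mset (u j) M" p'] Cons.prems that
    by (simp add: tens_def add_mset_commute[of "u j"])
  then show ?case
    by (simp add: sum_distrib_left sum.swap[of _ I])
qed

lemma form_rec_mset_zero:
  assumes F: "formal_function V F" and V: "loop.subspace V" and M: "set_mset M \<subseteq> V"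
    and us: "set us \<subseteq> tens R V"
  shows "form_rec R F p us (add_mset 0 M) l = 0"
  using form_rec_mset_sum[OF F V M _ _ us, where I = "{}"] by simp

context local_algebra
begin

text \<open>Since \<open>u\<close> reduces to \<open>0\<close>, replacing each basis element \<open>e\<^sub>i\<close> by \<open>e\<^sub>i - ares R i\<close>, which lies
  in the maximal ideal, does not change \<open>\<Sum>i. e\<^sub>i \<otimes> u i\<close>.\<close>

lemma form_rec_nilpotent:
  assumes F: "formal_function V F" and V: "loop.subspace V" and M: "set_mset M \<subseteq> V"
    and u: "u \<in> tens R V" "reduce R u = 0"
    and xs: "set xs \<subseteq> tens R V"
    and p: "p \<in> carrier (alg_ring R)"
    and nil: "\<And>y. (\<And>j. y j \<in> max_ideal R) \<Longrightarrow> alg_prod R p y k = (\<lambda>_. 0)"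
  shows "form_rec R F p (replicate k u @ xs) M l = 0"
  using M p nil
proof (induction k arbitrary: p M)
  case 0
  \<comment> \<open>With no factors left the hypothesis reads \<open>p = 0\<close>; the zero
    sequence merely supplies elements of the maximal ideal.\<close>
  have "p = (\<lambda>_. 0)" using "0.prems"(3)[of "\<lambda>_ _. 0"] max_ideal.zero_closed by simp
  then show ?case by simp
next
  case (Suc k)
  define m where "m = (\<lambda>i k. alg_basis i k + (- ares R i) * aunit R k)"
  have m: "m i \<in> max_ideal R" if "i < adim R" for i
    using that alg_basis_closed[OF that] unit_closed
    unfolding m_def max_ideal_def mem_Collect_eq residue_map_linear
    by (simp add: residue_one residue_map_basis alg_carrier_iff)
  have us: "set (replicate k u @ xs) \<subseteq> tens R V"
    using u xs by (auto split: if_splits)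
  have "alg_mult R p (alg_basis i) = (\<lambda>k. alg_mult R p (m i) k + ares R i * p k)" for i
    unfolding m_def alg_mult_add_right alg_mult_scale_right using r_one[OF Suc.prems(2)] by simp
  then have "form_rec R F p (replicate (Suc k) u @ xs) M l =
      (\<Sum>i<adim R. form_rec R F (alg_mult R p (m i)) (replicate k u @ xs) (add_mset (u i) M) l)
      + (\<Sum>i<adim R. ares R i * form_rec R F p (replicate k u @ xs) (add_mset (u i) M) l)"
    by (simp add: form_rec_linear sum.distrib)
  \<comment> \<open>The scalar parts of the \<open>e\<^sub>i\<close> leave the accumulator
    unchanged, so their sum amounts to inserting \<open>reduce R u\<close>, which is 0, into
    \<open>F\<close>.\<close>
  also have "(\<Sum>i<adim R. ares R i * form_rec R F p (replicate k u @ xs) (add_mset (u i) M) l) =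
      form_rec R F p (replicate k u @ xs) (add_mset (reduce R u) M) l"
    unfolding reduce_def using u(1)
    by (intro form_rec_mset_sum[OF F V Suc.prems(1) _ _ us, symmetric]) (auto simp: tens_def)
  also have "\<dots> = 0"
    unfolding u(2) by (rule form_rec_mset_zero[OF F V Suc.prems(1) us])
  also have "(\<Sum>i<adim R. form_rec R F (alg_mult R p (m i)) (replicate k u @ xs) (add_mset (u i) M) l) = 0"
  proof (intro sum.neutral ballI)
    fix i assume i: "i \<in> {..<adim R}"
    \<comment> \<open>The factor \<open>m i\<close>, prepended to \<open>y\<close>, is one of the
      \<open>k + 1\<close> factors that annihilate \<open>p\<close>; hence \<open>k\<close> more
      annihilate \<open>p m\<^sub>i\<close>.\<close>
    have "alg_prod R (alg_mult R p (m i)) y k = (\<lambda>_. 0)" if "\<And>j. y j \<in> max_ideal R" for y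
      using Suc.prems(3)[of "case_nat (m i) y"] that m i
      by (simp only: alg_prod_Suc_left) (simp split: nat.split)
    then show "form_rec R F (alg_mult R p (m i)) (replicate k u @ xs) (add_mset (u i) M) l = 0"
      using Suc.prems(1) u(1) i by (intro Suc.IH alg_mult_closed) (auto simp: tens_def)
  qed
  finally show ?case by simp
qed

text \<open>\<open>Sum_any\<close> returns 0 on an infinite support, so it is additive only once
  finiteness is known. All terms of order at least \<open>adim R\<close> vanish by
  nilpotency.\<close>

lemma finite_taylor_support:
  assumes F: "formal_function V F" and V: "loop.subspace V"
    and u: "u \<in> tens R V" "reduce R u = 0"
    and xs: "set xs \<subseteq> tens R V"
  shows "finite {k. form_rec R F (aunit R) (replicate k u @ xs) {#} l / fact k \<noteq> 0}"
proof (rule finite_subset)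
  show "{k. form_rec R F (aunit R) (replicate k u @ xs) {#} l / fact k \<noteq> 0} \<subseteq> {..<adim R}"
  proof (rule subsetI, rule ccontr)
    fix k assume "k \<notin> {..<adim R}"
    then have "form_rec R F (aunit R) (replicate k u @ xs) {#} l = 0"
      by (intro form_rec_nilpotent[OF F V _ u xs unit_closed] max_ideal_prod_eq_zero) auto
    moreover assume "k \<in> {k. form_rec R F (aunit R) (replicate k u @ xs) {#} l / fact k \<noteq> 0}"
    ultimately show False by simp
  qed
qed simp

end

section \<open>Dual numbers\<close>

text \<open>The algebra \<open>R[\<epsilon>]\<close> with \<open>\<epsilon>\<^sup>2 = 0\<close>, on
  the basis \<open>e\<^sub>0, ..., e\<^sub>d\<^sub>-\<^sub>1, \<epsilon> e\<^sub>0, ..., \<epsilon>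
  e\<^sub>d\<^sub>-\<^sub>1\<close>. A sequence vanishing from \<open>d\<close> on represents the
  same element over \<open>R\<close> and over \<open>R[\<epsilon>]\<close>, which is why
  \<open>aunit\<close> is unchanged.\<close>

definition dual_alg :: "fd_alg \<Rightarrow> fd_alg" where
  "dual_alg R =
     \<lparr>adim = adim R + adim R,
      sc = (\<lambda>i j k.
        if i < adim R \<and> j < adim R \<and> k < adim R then sc R i j k
        else if i < adim R \<and> adim R \<le> j \<and> adim R \<le> k then sc R i (j - adim R) (k - adim R)
        else if adim R \<le> i \<and> j < adim R \<and> adim R \<le> k then sc R (i - adim R) j (k - adim R)
        else 0),
      aunit = aunit R,
      ares = (\<lambda>i. if i < adim R then ares R i else 0)\<rparr>"

text \<open>For \<open>f\<close> over \<open>R[\<epsilon>]\<close>, this and \<open>eps_part\<close>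
  are the components \<open>f\<^sub>0\<close> and \<open>f\<^sub>1\<close> in
  \<open>f = f\<^sub>0 + \<epsilon> f\<^sub>1\<close>; \<open>dual_join\<close> puts them together.
  Cutting off at \<open>d\<close> makes them elements over \<open>R\<close>.\<close>

definition low_part :: "fd_alg \<Rightarrow> (nat \<Rightarrow> 'a::zero) \<Rightarrow> nat \<Rightarrow> 'a" where
  "low_part R f = (\<lambda>i. if i < adim R then f i else 0)"

definition eps_part :: "fd_alg \<Rightarrow> (nat \<Rightarrow> 'a::zero) \<Rightarrow> nat \<Rightarrow> 'a" where
  "eps_part R f = (\<lambda>i. if i < adim R then f (i + adim R) else 0)"

definition dual_join :: "fd_alg \<Rightarrow> (nat \<Rightarrow> 'a::zero) \<Rightarrow> (nat \<Rightarrow> 'a) \<Rightarrow> nat \<Rightarrow> 'a" where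
  "dual_join R f g =
     (\<lambda>i. if i < adim R then f i else if i < adim R + adim R then g (i - adim R) else 0)"

lemma dual_alg_sel [simp]:
  "adim (dual_alg R) = adim R + adim R" "aunit (dual_alg R) = aunit R"
  "ares (dual_alg R) i = (if i < adim R then ares R i else 0)"
  by (simp_all add: dual_alg_def)

lemma dual_alg_sc:
  assumes "i < adim R" "j < adim R" "k < adim R"
  shows "sc (dual_alg R) i j k = sc R i j k" "sc (dual_alg R) i j (k + adim R) = 0"
    "sc (dual_alg R) i (j + adim R) k = 0" "sc (dual_alg R) i (j + adim R) (k + adim R) = sc R i j k"
    "sc (dual_alg R) (i + adim R) j k = 0" "sc (dual_alg R) (i + adim R) j (k + adim R) = sc R i j k"
    "sc (dual_alg R) (i + adim R) (j + adim R) k = 0"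
    "sc (dual_alg R) (i + adim R) (j + adim R) (k + adim R) = 0"
  using assms by (simp_all add: dual_alg_def)

text \<open>Splits sums over the basis of \<open>R[\<epsilon>]\<close> into the part with
  \<open>e\<^sub>i\<close> and the part with \<open>\<epsilon> e\<^sub>i\<close>.\<close>

lemma sum_lessThan_add: "(\<Sum>i<m + n. f i) = (\<Sum>i<m. f i) + (\<Sum>i<n. f (i + m))"
  for f :: "nat \<Rightarrow> 'a::comm_monoid_add"
  by (induction n) (simp_all add: add_ac)

lemma dual_ext:
  assumes "\<And>i. i \<ge> adim R + adim R \<Longrightarrow> f i = 0" "\<And>i. i \<ge> adim R + adim R \<Longrightarrow> g i = 0"
    and "low_part R f = low_part R g" "eps_part R f = eps_part R g"
  shows "f = g"
proof
  fix i
  consider "i < adim R" | "adim R \<le> i" "i < adim R + adim R" | "adim R + adim R \<le> i" by linarith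
  then show "f i = g i"
  proof cases
    case 1
    then show ?thesis using fun_cong[OF assms(3), of i] by (simp add: low_part_def)
  next
    case 2
    then have "i - adim R < adim R" "i - adim R + adim R = i" by linarith+
    then show ?thesis using fun_cong[OF assms(4), of "i - adim R"] by (simp add: eps_part_def)
  qed (use assms in simp)
qed

lemma dual_carrier_eqI:
  assumes "r \<in> carrier (alg_ring (dual_alg R))" "s \<in> carrier (alg_ring (dual_alg R))"
    and "low_part R r = low_part R s" "eps_part R r = eps_part R s"
  shows "r = s"
  using assms by (intro dual_ext[of R r s]) (auto simp: alg_carrier_iff)

lemma part_closed:
  "low_part R r \<in> carrier (alg_ring R)" "eps_part R r \<in> carrier (alg_ring R)"
  "dual_join R r s \<in> carrier (alg_ring (dual_alg R))"
  by (auto simp: alg_carrier_iff low_part_def eps_part_def dual_join_def)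

lemma part_dual_join:
  assumes "\<And>i. i \<ge> adim R \<Longrightarrow> f i = 0" "\<And>i. i \<ge> adim R \<Longrightarrow> g i = 0"
  shows "low_part R (dual_join R f g) = f" "eps_part R (dual_join R f g) = g"
  using assms by (auto simp: fun_eq_iff low_part_def eps_part_def dual_join_def)

lemma part_of_low:
  assumes "\<And>i. i \<ge> adim R \<Longrightarrow> f i = 0"
  shows "low_part R f = f" "eps_part R f = (\<lambda>_. 0)"
  using assms by (auto simp: fun_eq_iff low_part_def eps_part_def)

lemma part_add:
  "low_part R (\<lambda>k. f k + g k) = (\<lambda>k. low_part R f k + low_part R g k)"
  "eps_part R (\<lambda>k. f k + g k) = (\<lambda>k. eps_part R f k + eps_part R g k)"
  for f g :: "nat \<Rightarrow> 'a::monoid_add"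
  by (auto simp: fun_eq_iff low_part_def eps_part_def)

lemma low_part_mult:
  "low_part R (alg_mult (dual_alg R) r s) = alg_mult R (low_part R r) (low_part R s)"
proof
  fix k
  show "low_part R (alg_mult (dual_alg R) r s) k = alg_mult R (low_part R r) (low_part R s) k"
    by (cases "k < adim R")
      (simp_all add: low_part_def alg_mult_nth sum_lessThan_add dual_alg_sc cong: sum.cong_simp)
qed

text \<open>The product rule: the term with two factors \<open>\<epsilon>\<close> has zero structure
  constants.\<close>

lemma eps_part_mult:
  "eps_part R (alg_mult (dual_alg R) r s) =
    (\<lambda>k. alg_mult R (low_part R r) (eps_part R s) k + alg_mult R (eps_part R r) (low_part R s) k)"
proof
  fix k
  show "eps_part R (alg_mult (dual_alg R) r s) k =
      alg_mult R (low_part R r) (eps_part R s) k + alg_mult R (eps_part R r) (low_part R s) k"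
    by (cases "k < adim R")
      (simp_all add: low_part_def eps_part_def alg_mult_nth sum_lessThan_add dual_alg_sc cong: sum.cong_simp)
qed

lemma residue_map_dual: "residue_map (dual_alg R) r = residue_map R (low_part R r)"
  by (simp add: residue_map_def sum_lessThan_add low_part_def cong: sum.cong_simp)

lemma max_ideal_dual:
  "r \<in> max_ideal (dual_alg R) \<longleftrightarrow>
     r \<in> carrier (alg_ring (dual_alg R)) \<and> low_part R r \<in> max_ideal R"
  by (simp add: max_ideal_def residue_map_dual part_closed)

context local_algebra
begin

text \<open>Associativity, commutativity and the unit law are compared on the two components, where
  they reduce to the laws of \<open>R\<close> and the product rule.\<close>

lemma cring_dual: "cring (alg_ring (dual_alg R))"
proof (rule cringI)
  show "abelian_group (alg_ring (dual_alg R))"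
  proof (rule abelian_groupI)
    fix x assume "x \<in> carrier (alg_ring (dual_alg R))"
    then have "(\<lambda>k. - x k) \<in> carrier (alg_ring (dual_alg R))"
      by (simp add: alg_carrier_iff)
    then show "\<exists>y\<in>carrier (alg_ring (dual_alg R)). y \<oplus>\<^bsub>alg_ring (dual_alg R)\<^esub> x = \<zero>\<^bsub>alg_ring (dual_alg R)\<^esub>"
      by (rule bexI[rotated]) simp
  qed (auto simp: alg_carrier_iff add_ac)
  show "comm_monoid (alg_ring (dual_alg R))"
  proof (rule comm_monoidI)
    fix x y z
    show "x \<otimes>\<^bsub>alg_ring (dual_alg R)\<^esub> y \<in> carrier (alg_ring (dual_alg R))"
      by (rule alg_mult_closed)
    show "\<one>\<^bsub>alg_ring (dual_alg R)\<^esub> \<in> carrier (alg_ring (dual_alg R))"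
      using unit_closed by (simp add: alg_carrier_iff)
    show "alg_mult (dual_alg R) (alg_mult (dual_alg R) x y) z =
        alg_mult (dual_alg R) x (alg_mult (dual_alg R) y z)"
      by (rule dual_carrier_eqI[of _ R])
        (simp_all add: alg_mult_closed low_part_mult eps_part_mult alg_mult_add_left alg_mult_add_right
          m_assoc part_closed add_ac)
    show "alg_mult (dual_alg R) x y = alg_mult (dual_alg R) y x"
      by (rule dual_carrier_eqI[of _ R])
        (simp_all add: alg_mult_closed low_part_mult eps_part_mult m_comm part_closed add_ac)
    show "\<one>\<^bsub>alg_ring (dual_alg R)\<^esub> \<otimes>\<^bsub>alg_ring (dual_alg R)\<^esub> x = x"
      if "x \<in> carrier (alg_ring (dual_alg R))"
    proof -
      have "low_part R (aunit R) = aunit R" "eps_part R (aunit R) = (\<lambda>_. 0)"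
        using unit_closed by (auto simp: alg_carrier_iff intro!: part_of_low)
      then show ?thesis
        by (intro dual_carrier_eqI[of "alg_mult _ _ _" R])
          (use l_one that in \<open>simp_all add: alg_mult_closed low_part_mult eps_part_mult part_closed
            alg_mult_zero\<close>)
    qed
  qed
  fix x y z
  show "(x \<oplus>\<^bsub>alg_ring (dual_alg R)\<^esub> y) \<otimes>\<^bsub>alg_ring (dual_alg R)\<^esub> z =
      x \<otimes>\<^bsub>alg_ring (dual_alg R)\<^esub> z \<oplus>\<^bsub>alg_ring (dual_alg R)\<^esub> y \<otimes>\<^bsub>alg_ring (dual_alg R)\<^esub> z"
    by (simp add: alg_mult_add_left)
qed

text \<open>The maximal ideal is the preimage of that of \<open>R\<close> under the homomorphism
  \<open>\<epsilon> \<mapsto> 0\<close>. Outside it the low part is invertible, and its inverse can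
  be corrected in the \<open>\<epsilon>\<close>-component.\<close>

lemma local_alg_dual: "local_alg (dual_alg R)"
proof -
  let ?D = "alg_ring (dual_alg R)"
  interpret D: cring ?D by (rule cring_dual)
  have lu: "low_part R (aunit R) = aunit R" "eps_part R (aunit R) = (\<lambda>_. 0)"
    using unit_closed by (auto simp: alg_carrier_iff intro!: part_of_low)
  have res1: "residue_map (dual_alg R) (aunit (dual_alg R)) = 1"
    by (simp add: residue_map_dual lu residue_one)
  have ideal: "ideal (max_ideal (dual_alg R)) ?D"
  proof -
    have "ring_hom_ring ?D (alg_ring R) (low_part R)"
      by (intro ring_hom_ringI D.ring_axioms ring_axioms)
        (simp_all add: part_closed low_part_mult part_add lu)
    from ring_hom_ring.ideal_vimage[OF this max_ideal.is_ideal]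
    have "ideal {r \<in> carrier ?D. low_part R r \<in> max_ideal R} ?D" .
    then show ?thesis by (simp add: max_ideal_dual[symmetric])
  qed
  have "carrier ?D - max_ideal (dual_alg R) \<subseteq> Units ?D"
  proof
    fix r assume r: "r \<in> carrier ?D - max_ideal (dual_alg R)"
    define s q where "s = low_part R r" and "q = eps_part R r"
    have c: "s \<in> carrier (alg_ring R)" "q \<in> carrier (alg_ring R)"
      by (simp_all add: s_def q_def part_closed)
    have "s \<notin> max_ideal R"
      using r unfolding s_def by (meson DiffD1 DiffD2 max_ideal_dual)
    then have "residue_map R s \<noteq> 0"
      using c(1) unfolding max_ideal_def by blast
    then obtain t where t: "t \<in> carrier (alg_ring R)" "alg_mult R s t = aunit R"
      using exists_inverse c by blast
    \<comment> \<open>\<open>(s + \<epsilon> q)\<^sup>-\<^sup>1 = s\<^sup>-\<^sup>1 - \<epsilon> s\<^sup>-\<^sup>2 q\<close>\<close>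
    define y where "y = dual_join R t (\<lambda>k. (-1) * alg_mult R t (alg_mult R t q) k)"
    have y_parts: "low_part R y = t" "eps_part R y = (\<lambda>k. (-1) * alg_mult R t (alg_mult R t q) k)"
      using t alg_mult_closed[of R t "alg_mult R t q"] unfolding y_def
      by (auto intro!: part_dual_join simp: alg_carrier_iff)
    have "alg_mult R s (alg_mult R t (alg_mult R t q)) = alg_mult R (alg_mult R s t) (alg_mult R t q)"
      by (rule m_assoc[symmetric]) (simp_all add: c t alg_mult_closed)
    also have "\<dots> = alg_mult R q t"
      using l_one[OF alg_mult_closed] m_comm[OF c(2) t(1)] by (simp add: t(2))
    finally have "alg_mult R s (alg_mult R t (alg_mult R t q)) = alg_mult R q t" .
    then have "eps_part R (alg_mult (dual_alg R) r y) = eps_part R (aunit R)"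
      unfolding eps_part_mult y_parts alg_mult_scale_right lu(2) by (simp add: s_def q_def)
    moreover have "low_part R (alg_mult (dual_alg R) r y) = low_part R (aunit R)"
      unfolding low_part_mult y_parts lu(1) using t(2) by (simp add: s_def)
    ultimately have "alg_mult (dual_alg R) r y = aunit R"
      using dual_carrier_eqI[OF alg_mult_closed, of "aunit R" R] D.one_closed by simp
    moreover have "y \<in> carrier ?D" by (simp add: y_def part_closed)
    ultimately show "r \<in> Units ?D"
      using r D.m_comm[of r y] by (auto simp: Units_def intro!: bexI[of _ y])
  qed
  moreover have "\<one>\<^bsub>?D\<^esub> \<notin> max_ideal (dual_alg R)"
    using res1 by (simp add: max_ideal_def)
  ultimately show ?thesis
    unfolding local_alg_def using D.maximalideal_unique_iff[OF ideal] cring_dual res1 by blast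
qed

end

section \<open>Base change to the dual numbers\<close>

lemma dual_basis_parts:
  assumes "i < adim R"
  shows "low_part R (alg_basis i) = alg_basis i" "eps_part R (alg_basis i) = (\<lambda>_. 0)"
    "low_part R (alg_basis (i + adim R)) = (\<lambda>_. 0)" "eps_part R (alg_basis (i + adim R)) = alg_basis i"
  using assms by (auto simp: fun_eq_iff low_part_def eps_part_def alg_basis_def)

text \<open>Setting \<open>\<epsilon> = 0\<close> commutes with the recursion: choosing some
  \<open>\<epsilon> e\<^sub>i\<close> leaves an accumulator with zero low part.\<close>

lemma form_rec_dual_low:
  assumes "l < adim R"
  shows "form_rec (dual_alg R) F p us M l = form_rec R F (low_part R p) (map (low_part R) us) M l"
proof (induction us arbitrary: p M)
  case Nil
  then show ?case using assms by (simp add: low_part_def)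
next
  case (Cons u us)
  have "u i = low_part R u i" if "i < adim R" for i
    using that by (simp add: low_part_def)
  then show ?case
    by (simp add: sum_lessThan_add Cons low_part_mult dual_basis_parts alg_mult_zero cong: sum.cong_simp)
qed

text \<open>Once the accumulator is a multiple of \<open>\<epsilon>\<close>, a further
  \<open>\<epsilon>\<close> kills it, so only the low parts of the remaining arguments
  count.\<close>

lemma form_rec_dual_eps_pure:
  assumes "l < adim R" "low_part R p = (\<lambda>_. 0)"
  shows "form_rec (dual_alg R) F p us M (l + adim R) =
    form_rec R F (eps_part R p) (map (low_part R) us) M l"
  using assms(2)
proof (induction us arbitrary: p M)
  case Nil
  then show ?case using assms(1) by (simp add: eps_part_def)
next
  case (Cons u us)
  have "u i = low_part R u i" if "i < adim R" for i
    using that by (simp add: low_part_def)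
  then show ?case
    using Cons.prems
    by (simp add: sum_lessThan_add Cons.IH low_part_mult eps_part_mult dual_basis_parts alg_mult_zero
        cong: sum.cong_simp)
qed

text \<open>One step of the product rule: the first argument contributes either some
  \<open>e\<^sub>i\<close>, leaving the \<open>\<epsilon>\<close> to the others, or some
  \<open>\<epsilon> e\<^sub>i\<close>, after which the others enter by their low parts.\<close>

lemma form_rec_dual_Cons:
  assumes l: "l < adim R" and p: "p \<in> carrier (alg_ring R)"
  shows "form_rec (dual_alg R) F p (u # us) M (l + adim R) =
    (\<Sum>i<adim R. form_rec (dual_alg R) F (alg_mult R p (alg_basis i)) us (add_mset (u i) M) (l + adim R))
    + form_rec R F p (eps_part R u # map (low_part R) us) M l"
proof -
  have pp: "low_part R p = p" "eps_part R p = (\<lambda>_. 0)"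
    using p by (auto simp: alg_carrier_iff intro!: part_of_low)
  have "alg_mult (dual_alg R) p (alg_basis i) = alg_mult R p (alg_basis i)" if "i < adim R" for i
  proof (rule dual_carrier_eqI[of _ R])
    have c: "\<And>k. k \<ge> adim R \<Longrightarrow> alg_mult R p (alg_basis i) k = 0"
      by (simp add: alg_mult_nth)
    show "alg_mult R p (alg_basis i) \<in> carrier (alg_ring (dual_alg R))"
      using c by (simp add: alg_carrier_iff)
  qed (use that pp in \<open>simp_all add: alg_mult_closed low_part_mult eps_part_mult dual_basis_parts
      alg_mult_zero part_of_low[of R "alg_mult R p (alg_basis i)"] alg_mult_nth\<close>)
  moreover have "form_rec (dual_alg R) F (alg_mult (dual_alg R) p (alg_basis (i + adim R))) us M' (l + adim R) =
      form_rec R F (alg_mult R p (alg_basis i)) (map (low_part R) us) M' l" if "i < adim R" for i M'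
    using that l pp
    by (subst form_rec_dual_eps_pure)
      (simp_all add: low_part_mult eps_part_mult dual_basis_parts alg_mult_zero)
  ultimately show ?thesis
    by (simp add: sum_lessThan_add eps_part_def cong: sum.cong_simp)
qed

lemma tens_zero: "f \<in> tens R S \<Longrightarrow> i \<ge> adim R \<Longrightarrow> f i = 0"
  by (simp add: tens_def)

lemma tens_dual:
  assumes "f \<in> tens R S" "0 \<in> S"
  shows "f \<in> tens (dual_alg R) S"
  using assms by (auto simp: tens_def) (metis leI)

lemma tens_parts:
  assumes "f \<in> tens (dual_alg R) S"
  shows "low_part R f \<in> tens R S" "eps_part R f \<in> tens R S"
  using assms by (auto simp: tens_def low_part_def eps_part_def)

lemma tens_dual_join:
  assumes "f \<in> tens R S" "g \<in> tens R S"
  shows "dual_join R f g \<in> tens (dual_alg R) S"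
  using assms by (auto simp: tens_def dual_join_def)

lemma tens_low:
  assumes "f \<in> tens R S"
  shows "low_part R f = f" "eps_part R f = (\<lambda>_. 0)"
  using part_of_low[of R f] tens_zero[OF assms] by auto

lemma form_rec_outside:
  assumes "p \<in> carrier (alg_ring R)" "l \<ge> adim R"
  shows "form_rec R F p us M l = 0"
  using assms(1)
proof (induction us arbitrary: p M)
  case Nil
  then show ?case using assms(2) by (simp add: alg_carrier_iff)
qed (simp add: alg_mult_closed)

lemma form_rec_zero_arg:
  assumes F: "formal_function V F" and V: "loop.subspace V" and M: "set_mset M \<subseteq> V"
    and us: "set us \<subseteq> tens R V" "(\<lambda>_. 0) \<in> set us"
  shows "form_rec R F p us M l = 0"
  using M us
proof (induction us arbitrary: p M)
  case (Cons u us)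
  show ?case
  proof (cases "u = (\<lambda>_. 0)")
    case True
    then show ?thesis using form_rec_mset_zero[OF F V Cons.prems(1)] Cons.prems(2) by simp
  next
    case False
    then show ?thesis using Cons by (auto simp: tens_def intro!: sum.neutral)
  qed
qed simp

text \<open>Prepending copies of a vector \<open>u\<close> without \<open>\<epsilon>\<close>-part
  does not affect the product rule for the directions \<open>xs\<close>. The two lists
  \<open>ys\<close> and \<open>zs\<close> are the two terms of that rule for a pair.\<close>

lemma form_rec_dual_replicate:
  assumes F: "formal_function V F" and V: "loop.subspace V" and M: "set_mset M \<subseteq> V"
    and u: "u \<in> tens R V" and xs: "set xs \<subseteq> tens (dual_alg R) V"
    and l: "l < adim R" and p: "p \<in> carrier (alg_ring R)"
    and base: "\<And>p M. p \<in> carrier (alg_ring R) \<Longrightarrow> set_mset M \<subseteq> V \<Longrightarrow>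
      form_rec (dual_alg R) F p xs M (l + adim R) = form_rec R F p ys M l + form_rec R F p zs M l"
  shows "form_rec (dual_alg R) F p (replicate k u @ xs) M (l + adim R) =
    form_rec R F p (replicate k u @ ys) M l + form_rec R F p (replicate k u @ zs) M l"
  using M p
proof (induction k arbitrary: p M)
  case 0
  then show ?case using base by simp
next
  case (Suc k)
  have us: "set (map (low_part R) (replicate k u @ xs)) \<subseteq> tens R V"
    using u xs tens_parts(1) tens_low(1)[OF u] by (auto split: if_splits)
  \<comment> \<open>The term in which a copy of \<open>u\<close> supplies the
    \<open>\<epsilon>\<close> has a zero argument.\<close>
  have "form_rec R F p (eps_part R u # map (low_part R) (replicate k u @ xs)) M l = 0"
    using form_rec_mset_zero[OF F V Suc.prems(1) us] unfolding tens_low(2)[OF u] by simp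
  then have "form_rec (dual_alg R) F p (replicate (Suc k) u @ xs) M (l + adim R) =
      (\<Sum>i<adim R. form_rec (dual_alg R) F (alg_mult R p (alg_basis i)) (replicate k u @ xs)
        (add_mset (u i) M) (l + adim R))"
    using form_rec_dual_Cons[OF l Suc.prems(2), of F u "replicate k u @ xs" M]
    by (simp only: replicate_Suc append_Cons add_0_right)
  also have "\<dots> = (\<Sum>i<adim R.
      form_rec R F (alg_mult R p (alg_basis i)) (replicate k u @ ys) (add_mset (u i) M) l +
      form_rec R F (alg_mult R p (alg_basis i)) (replicate k u @ zs) (add_mset (u i) M) l)"
    using Suc.prems(1) u by (intro sum.cong refl Suc.IH alg_mult_closed) (simp add: tens_def)
  finally show ?case by (simp add: sum.distrib)
qed

lemma form_rec_dual_single: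
  assumes l: "l < adim R" and p: "p \<in> carrier (alg_ring R)"
  shows "form_rec (dual_alg R) F p [x] M (l + adim R) = form_rec R F p [eps_part R x] M l"
  \<comment> \<open>In the other sum the accumulators lie in \<open>R\<close> and have no
    coefficient at index \<open>l + adim R\<close>.\<close>
  using form_rec_dual_Cons[OF assms, of F x "[]" M] by (simp only: list.map) (simp add: alg_mult_nth)

lemma form_rec_dual_pair:
  assumes l: "l < adim R" and p: "p \<in> carrier (alg_ring R)"
  shows "form_rec (dual_alg R) F p [x, y] M (l + adim R) =
    form_rec R F p [eps_part R x, low_part R y] M l + form_rec R F p [low_part R x, eps_part R y] M l"
proof -
  have "(\<Sum>i<adim R. form_rec (dual_alg R) F (alg_mult R p (alg_basis i)) [y] (add_mset (x i) M) (l + adim R)) =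
      form_rec R F p [low_part R x, eps_part R y] M l"
    unfolding form_rec_dual_single[OF l alg_mult_closed] by (simp add: low_part_def)
  then show ?thesis
    using form_rec_dual_Cons[OF l p, of F x "[y]" M] by (simp only: list.map add.commute)
qed

lemma Omega_ext_dual:
  "low_part R (Omega_ext B (dual_alg R) f g) = Omega_ext B R (low_part R f) (low_part R g)"
  "eps_part R (Omega_ext B (dual_alg R) f g) =
    (\<lambda>k. Omega_ext B R (low_part R f) (eps_part R g) k + Omega_ext B R (eps_part R f) (low_part R g) k)"
  by (auto simp: fun_eq_iff Omega_ext_def low_part_def eps_part_def sum_lessThan_add dual_alg_sc
      cong: sum.cong_simp)

lemma reduce_dual: "reduce (dual_alg R) f = reduce R (low_part R f)"
  by (simp add: reduce_def sum_lessThan_add low_part_def cong: sum.cong_simp)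

lemma Omega_zero:
  assumes "nondeg_sym_bilinear B"
  shows "Omega B 0 f = 0" "Omega B f 0 = 0"
proof -
  have lin: "Vector_Spaces.linear (*s) (*) (B x)" and sym: "B x y = B y x" for x y
    using assms unfolding nondeg_sym_bilinear_def by auto
  have B0: "B x 0 = 0" for x
  proof -
    interpret Vector_Spaces.linear "(*s)" "(*)" "B x" by (rule lin)
    show ?thesis by (rule zero)
  qed
  then have "B 0 x = 0" for x using sym by metis
  with B0 show "Omega B 0 f = 0" "Omega B f 0 = 0"
    by (auto simp: Omega_def conv_nth intro!: sum.neutral)
qed

lemma Omega_ext_zero:
  assumes "nondeg_sym_bilinear B"
  shows "Omega_ext B R (\<lambda>_. 0) f = (\<lambda>_. 0)" "Omega_ext B R f (\<lambda>_. 0) = (\<lambda>_. 0)"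
  by (simp_all add: Omega_ext_def Omega_zero[OF assms] fun_eq_iff)

section \<open>Derivatives of formal functions over the dual numbers\<close>

context local_algebra
begin

lemma local_algebra_dual: "local_algebra (dual_alg R)"
  by unfold_locales (rule local_alg_dual)

lemma ff_deriv_eq_rec:
  "ff_deriv R F u xs l = Sum_any (\<lambda>k. form_rec R F (aunit R) (replicate k u @ xs) {#} l / fact k)"
  by (simp add: ff_deriv_def form_ext_eq_rec)

lemma ff_deriv_outside: "l \<ge> adim R \<Longrightarrow> ff_deriv R F u xs l = 0"
  by (simp add: ff_deriv_eq_rec form_rec_outside[OF unit_closed])

lemma ff_deriv_dual_low:
  assumes "u \<in> tens R V"
  shows "low_part R (ff_deriv (dual_alg R) F u xs) = ff_deriv R F u (map (low_part R) xs)"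
proof
  fix l
  show "low_part R (ff_deriv (dual_alg R) F u xs) l = ff_deriv R F u (map (low_part R) xs) l"
  proof (cases "l < adim R")
    case True
    have "low_part R (aunit R) = aunit R"
      using unit_closed by (auto simp: alg_carrier_iff intro!: part_of_low)
    moreover have "low_part R (ff_deriv (dual_alg R) F u xs) l = ff_deriv (dual_alg R) F u xs l"
      using True by (simp add: low_part_def)
    ultimately show ?thesis
      by (simp add: local_algebra.ff_deriv_eq_rec[OF local_algebra_dual] ff_deriv_eq_rec
          form_rec_dual_low[OF True] tens_low[OF assms])
  qed (simp add: low_part_def ff_deriv_outside)
qed

lemma ff_deriv_zero_arg:
  assumes F: "formal_function V F" and V: "loop.subspace V"
    and u: "u \<in> tens R V" and xs: "set xs \<subseteq> tens R V" "(\<lambda>_. 0) \<in> set xs"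
  shows "ff_deriv R F u xs = (\<lambda>_. 0)"
proof -
  have "form_rec R F (aunit R) (replicate k u @ xs) {#} l = 0" for k l
    using u xs by (intro form_rec_zero_arg[OF F V]) (auto split: if_splits)
  then show ?thesis by (simp add: fun_eq_iff ff_deriv_eq_rec)
qed

lemma ff_deriv_dual_eps_single:
  assumes F: "formal_function V F" and V: "loop.subspace V"
    and u: "u \<in> tens R V" and x: "x \<in> tens (dual_alg R) V"
  shows "eps_part R (ff_deriv (dual_alg R) F u [x]) = ff_deriv R F u [eps_part R x]"
proof
  fix l
  have zero: "(\<lambda>_. 0) \<in> tens R V"
    using loop.subspace_0[OF V] by (simp add: tens_def)
  show "eps_part R (ff_deriv (dual_alg R) F u [x]) l = ff_deriv R F u [eps_part R x] l"
  proof (cases "l < adim R")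
    case True
    \<comment> \<open>A zero summand is added to match the two-term shape of
      \<open>form_rec_dual_replicate\<close>.\<close>
    have "form_rec (dual_alg R) F p [x] M (l + adim R) =
        form_rec R F p [eps_part R x] M l + form_rec R F p [\<lambda>_. 0] M l"
      if "p \<in> carrier (alg_ring R)" "set_mset M \<subseteq> V" for p M
      using form_rec_dual_single[OF True that(1)] form_rec_zero_arg[OF F V that(2), of "[\<lambda>_. 0]"] zero
      by (simp del: form_rec.simps)
    then have "form_rec (dual_alg R) F (aunit R) (replicate k u @ [x]) {#} (l + adim R) =
        form_rec R F (aunit R) (replicate k u @ [eps_part R x]) {#} l
        + form_rec R F (aunit R) (replicate k u @ [\<lambda>_. 0]) {#} l" for k
      using x by (intro form_rec_dual_replicate[OF F V _ u _ True unit_closed]) auto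
    moreover have "form_rec R F (aunit R) (replicate k u @ [\<lambda>_. 0]) {#} l = 0" for k
      using u zero by (intro form_rec_zero_arg[OF F V]) (auto split: if_splits)
    ultimately show ?thesis
      using True
      by (simp add: eps_part_def local_algebra.ff_deriv_eq_rec[OF local_algebra_dual] ff_deriv_eq_rec)
  qed (simp add: eps_part_def ff_deriv_outside)
qed

text \<open>The product rule for the second derivative at a point defined over \<open>R\<close>.
  Splitting the series in two requires finite supports, whence the hypothesis
  \<open>reduce R u = 0\<close>.\<close>

lemma ff_deriv_dual_eps_pair:
  assumes F: "formal_function V F" and V: "loop.subspace V"
    and u: "u \<in> tens R V" "reduce R u = 0"
    and x: "x \<in> tens (dual_alg R) V" and y: "y \<in> tens (dual_alg R) V"
  shows "eps_part R (ff_deriv (dual_alg R) F u [x, y]) =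
    (\<lambda>l. ff_deriv R F u [low_part R x, eps_part R y] l + ff_deriv R F u [eps_part R x, low_part R y] l)"
proof
  fix l
  show "eps_part R (ff_deriv (dual_alg R) F u [x, y]) l =
    ff_deriv R F u [low_part R x, eps_part R y] l + ff_deriv R F u [eps_part R x, low_part R y] l"
  proof (cases "l < adim R")
    case True
    have "form_rec (dual_alg R) F (aunit R) (replicate k u @ [x, y]) {#} (l + adim R) =
        form_rec R F (aunit R) (replicate k u @ [eps_part R x, low_part R y]) {#} l
        + form_rec R F (aunit R) (replicate k u @ [low_part R x, eps_part R y]) {#} l" for k
      using x y
      by (intro form_rec_dual_replicate[OF F V _ u(1) _ True unit_closed] form_rec_dual_pair[OF True])
        auto
    then have "eps_part R (ff_deriv (dual_alg R) F u [x, y]) l =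
        Sum_any (\<lambda>k. form_rec R F (aunit R) (replicate k u @ [eps_part R x, low_part R y]) {#} l / fact k
          + form_rec R F (aunit R) (replicate k u @ [low_part R x, eps_part R y]) {#} l / fact k)"
      using True
      by (simp add: eps_part_def local_algebra.ff_deriv_eq_rec[OF local_algebra_dual] add_divide_distrib)
    also have "\<dots> = ff_deriv R F u [eps_part R x, low_part R y] l + ff_deriv R F u [low_part R x, eps_part R y] l"
      unfolding ff_deriv_eq_rec using tens_parts[OF x] tens_parts[OF y]
      by (intro Sum_any.distrib finite_taylor_support[OF F V u]) auto
    finally show ?thesis by simp
  qed (simp add: eps_part_def ff_deriv_outside)
qed

end

section \<open>Points and tangent spaces of the germ under base change\<close>

lemma zmul_zero: "zmul 0 = 0"
  by (auto intro!: fls_eqI)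

lemma l0_zero: "l0 a 0 = 0"
  by (auto intro!: fls_eqI simp: l0_def conv_nth)

text \<open>The algebra is a parameter, so that every result can be reused for the same germ over
  \<open>dual_alg R\<close>.\<close>

locale germ_over_algebra = local_algebra R for R :: fd_alg +
  fixes B :: "complex^'n::finite \<Rightarrow> complex^'n \<Rightarrow> complex" and \<L> :: "'n germ"
  assumes form: "nondeg_sym_bilinear B" and germ: "lagrangian_germ B \<L>"
begin

lemma subspace_V: "loop.subspace (gV \<L>)" and subspace_W: "loop.subspace (gW \<L>)"
  and V_Int_W: "gV \<L> \<inter> gW \<L> = {0}"
  and v0_in_V: "gv0 \<L> \<in> gV \<L>" and formal_F: "formal_function (gV \<L>) (gF \<L>)"
  using germ by (auto simp: lagrangian_germ_def lagrangian_splitting_def lagrangian_def)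

lemma decomposition_unique:
  assumes "v \<in> tens R (gV \<L>)" "w \<in> tens R (gW \<L>)" "v' \<in> tens R (gV \<L>)" "w' \<in> tens R (gW \<L>)"
    and eq: "(\<lambda>i. v i + w i) = (\<lambda>i. v' i + w' i)"
  shows "v = v' \<and> w = w'"
proof -
  have "v i = v' i \<and> w i = w' i" for i
  proof (cases "i < adim R")
    case True
    have "v i - v' i = w' i - w i"
      using fun_cong[OF eq, of i] by (simp add: algebra_simps)
    moreover have "v i - v' i \<in> gV \<L>" "w' i - w i \<in> gW \<L>"
      using True assms by (auto simp: tens_def intro!: loop.subspace_diff subspace_V subspace_W)
    ultimately show ?thesis using V_Int_W by force
  qed (use assms in \<open>simp add: tens_def\<close>)
  then show ?thesis by auto
qed

text \<open>The increment of \<open>v\<close> from the base point, in which Taylor series are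
  expanded. It reduces to 0 because the unit of \<open>R\<close> has residue 1.\<close>

definition offset :: "(nat \<Rightarrow> 'n loop) \<Rightarrow> nat \<Rightarrow> 'n loop" where
  "offset v = (\<lambda>i. v i - const_pt R (gv0 \<L>) i)"

lemma offset:
  assumes "on_graph B \<L> R v w"
  shows "offset v \<in> tens R (gV \<L>)" "reduce R (offset v) = 0"
proof -
  have v: "v \<in> tens R (gV \<L>)" "reduce R v = gv0 \<L>" using assms by (auto simp: on_graph_def)
  show "offset v \<in> tens R (gV \<L>)"
    using v(1) unit_closed
    by (auto simp: offset_def tens_def const_pt_def alg_carrier_iff
        intro!: loop.subspace_diff subspace_V loop.subspace_scale v0_in_V)
  have "reduce R (offset v) = reduce R v - loop_scale (residue_map R (aunit R)) (gv0 \<L>)"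
    by (simp add: reduce_def offset_def const_pt_def residue_map_def loop.scale_right_diff_distrib
        sum_subtractf loop.scale_sum_left)
  then show "reduce R (offset v) = 0" using v(2) by (simp add: residue_one)
qed

text \<open>The definition quantifies over all decompositions of the point; since \<open>V\<close>
  and \<open>W\<close> meet only in 0, the decomposition is the given one.\<close>

lemma tangent_space_iff:
  assumes g: "on_graph B \<L> R v w"
  shows "h \<in> tangent_space B \<L> R (\<lambda>i. v i + w i) \<longleftrightarrow>
    (\<exists>x\<in>tens R (gV \<L>). \<exists>y\<in>tens R (gW \<L>). h = (\<lambda>i. x i + y i) \<and>
      (\<forall>x'\<in>tens R (gV \<L>). Omega_ext B R y x' = ff_deriv R (gF \<L>) (offset v) [x, x']))"
proof -
  have "v' = v \<and> w' = w"
    if "on_graph B \<L> R v' w'" "(\<lambda>i. v i + w i) = (\<lambda>i. v' i + w' i)" for v' w'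
    using decomposition_unique[of v' w' v w] that g by (simp add: on_graph_def)
  then show ?thesis
    using g unfolding tangent_space_def mem_Collect_eq offset_def by blast
qed

text \<open>Both components of the graph equation over \<open>R[\<epsilon>]\<close> are graph
  equations over \<open>R\<close>, tested on the low part and on the \<open>\<epsilon>\<close>-part
  of \<open>x\<close>.\<close>

lemma on_graph_dual:
  assumes g: "on_graph B \<L> R v w"
  shows "on_graph B \<L> (dual_alg R) v w"
proof -
  have v: "v \<in> tens R (gV \<L>)" and w: "w \<in> tens R (gW \<L>)"
    and red: "reduce R v = gv0 \<L>" "reduce R w = gw0 \<L>"
    and eq: "\<And>x. x \<in> tens R (gV \<L>) \<Longrightarrow> Omega_ext B R w x = ff_deriv R (gF \<L>) (offset v) [x]"
    using g by (auto simp: on_graph_def offset_def)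
  have "Omega_ext B (dual_alg R) w x = ff_deriv (dual_alg R) (gF \<L>) (offset v) [x]"
    if x: "x \<in> tens (dual_alg R) (gV \<L>)" for x
  proof (rule dual_ext[of R])
    show "low_part R (Omega_ext B (dual_alg R) w x) =
        low_part R (ff_deriv (dual_alg R) (gF \<L>) (offset v) [x])"
      using eq[OF tens_parts(1)[OF x]]
      by (simp add: Omega_ext_dual tens_low[OF w] ff_deriv_dual_low[OF offset(1)[OF g]])
    show "eps_part R (Omega_ext B (dual_alg R) w x) =
        eps_part R (ff_deriv (dual_alg R) (gF \<L>) (offset v) [x])"
      using eq[OF tens_parts(2)[OF x]]
      by (simp add: Omega_ext_dual tens_low[OF w] Omega_ext_zero[OF form]
          ff_deriv_dual_eps_single[OF formal_F subspace_V offset(1)[OF g] x])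
  qed (simp_all add: Omega_ext_def local_algebra.ff_deriv_outside[OF local_algebra_dual])
  then show ?thesis
    using tens_dual[OF v loop.subspace_0[OF subspace_V]] tens_dual[OF w loop.subspace_0[OF subspace_W]] red
    by (simp add: on_graph_def reduce_dual tens_low[OF v] tens_low[OF w] offset_def const_pt_def)
qed

lemma points_dual: "f \<in> points B \<L> R \<Longrightarrow> f \<in> points B \<L> (dual_alg R)"
  unfolding points_def using on_graph_dual by blast

lemma germ_over_algebra_dual: "germ_over_algebra (dual_alg R) B \<L>"
  by (intro germ_over_algebra.intro local_algebra_dual germ_over_algebra_axioms.intro form germ)

lemma offset_dual: "germ_over_algebra.offset (dual_alg R) \<L> = offset"
  by (simp add: fun_eq_iff germ_over_algebra.offset_def[OF germ_over_algebra_dual] offset_def const_pt_def)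

text \<open>The low component of the tangency equation is the one for \<open>g\<close>. The
  \<open>\<epsilon>\<close>-component is the equation for \<open>g\<close> at the
  \<open>\<epsilon>\<close>-part of the test vector plus the equation for \<open>h\<close> at its
  low part.\<close>

lemma tangent_space_dual_join:
  assumes f: "f \<in> points B \<L> R"
    and g: "g \<in> tangent_space B \<L> R f" and h: "h \<in> tangent_space B \<L> R f"
  shows "dual_join R g h \<in> tangent_space B \<L> (dual_alg R) f"
proof -
  obtain v w where f_eq: "f = (\<lambda>i. v i + w i)" and graph: "on_graph B \<L> R v w"
    using f by (auto simp: points_def)
  obtain x y where x: "x \<in> tens R (gV \<L>)" and y: "y \<in> tens R (gW \<L>)" and g_eq: "g = (\<lambda>i. x i + y i)"
    and xy: "\<And>x'. x' \<in> tens R (gV \<L>) \<Longrightarrow> Omega_ext B R y x' = ff_deriv R (gF \<L>) (offset v) [x, x']"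
    using g unfolding f_eq tangent_space_iff[OF graph] by blast
  obtain p q where p: "p \<in> tens R (gV \<L>)" and q: "q \<in> tens R (gW \<L>)" and h_eq: "h = (\<lambda>i. p i + q i)"
    and pq: "\<And>x'. x' \<in> tens R (gV \<L>) \<Longrightarrow> Omega_ext B R q x' = ff_deriv R (gF \<L>) (offset v) [p, x']"
    using h unfolding f_eq tangent_space_iff[OF graph] by blast
  define X Y where "X = dual_join R x p" and "Y = dual_join R y q"
  have X: "X \<in> tens (dual_alg R) (gV \<L>)" "low_part R X = x" "eps_part R X = p"
    using x p by (auto simp: X_def tens_dual_join part_dual_join tens_zero)
  have Y: "Y \<in> tens (dual_alg R) (gW \<L>)" "low_part R Y = y" "eps_part R Y = q"
    using y q by (auto simp: Y_def tens_dual_join part_dual_join tens_zero)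
  have "Omega_ext B (dual_alg R) Y x' = ff_deriv (dual_alg R) (gF \<L>) (offset v) [X, x']"
    if x': "x' \<in> tens (dual_alg R) (gV \<L>)" for x'
  proof (rule dual_ext[of R])
    show "low_part R (Omega_ext B (dual_alg R) Y x') =
        low_part R (ff_deriv (dual_alg R) (gF \<L>) (offset v) [X, x'])"
      using xy[OF tens_parts(1)[OF x']]
      by (simp add: Omega_ext_dual X Y ff_deriv_dual_low[OF offset(1)[OF graph]])
    show "eps_part R (Omega_ext B (dual_alg R) Y x') =
        eps_part R (ff_deriv (dual_alg R) (gF \<L>) (offset v) [X, x'])"
      using xy[OF tens_parts(2)[OF x']] pq[OF tens_parts(1)[OF x']]
      by (simp add: Omega_ext_dual X Y ff_deriv_dual_eps_pair[OF formal_F subspace_V offset[OF graph] X(1) x'])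
  qed (simp_all add: Omega_ext_def local_algebra.ff_deriv_outside[OF local_algebra_dual])
  moreover have "dual_join R g h = (\<lambda>i. X i + Y i)"
    by (simp add: fun_eq_iff X_def Y_def dual_join_def g_eq h_eq)
  ultimately show ?thesis
    using X(1) Y(1)
    unfolding f_eq germ_over_algebra.tangent_space_iff[OF germ_over_algebra_dual on_graph_dual[OF graph]]
      offset_dual
    by blast
qed

text \<open>Test vectors defined over \<open>R\<close> suffice: for them the
  \<open>\<epsilon>\<close>-component of the tangency equation involves only the
  \<open>\<epsilon>\<close>-parts of \<open>X\<close> and \<open>Y\<close>.\<close>

lemma tangent_space_eps_part:
  assumes f: "f \<in> points B \<L> R" and g: "g \<in> tangent_space B \<L> (dual_alg R) f"
  shows "eps_part R g \<in> tangent_space B \<L> R f"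
proof -
  obtain v w where f_eq: "f = (\<lambda>i. v i + w i)" and graph: "on_graph B \<L> R v w"
    using f by (auto simp: points_def)
  obtain X Y where X: "X \<in> tens (dual_alg R) (gV \<L>)" and Y: "Y \<in> tens (dual_alg R) (gW \<L>)"
    and g_eq: "g = (\<lambda>i. X i + Y i)"
    and XY: "\<And>x'. x' \<in> tens (dual_alg R) (gV \<L>) \<Longrightarrow>
      Omega_ext B (dual_alg R) Y x' = ff_deriv (dual_alg R) (gF \<L>) (offset v) [X, x']"
    using g unfolding f_eq offset_dual
      germ_over_algebra.tangent_space_iff[OF germ_over_algebra_dual on_graph_dual[OF graph]]
    by blast
  have "Omega_ext B R (eps_part R Y) x' = ff_deriv R (gF \<L>) (offset v) [eps_part R X, x']"
    if x': "x' \<in> tens R (gV \<L>)" for x'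
  proof -
    have x'_dual: "x' \<in> tens (dual_alg R) (gV \<L>)"
      by (rule tens_dual[OF x' loop.subspace_0[OF subspace_V]])
    have zero: "ff_deriv R (gF \<L>) (offset v) [low_part R X, \<lambda>_. 0] = (\<lambda>_. 0)"
      using tens_parts(1)[OF X] loop.subspace_0[OF subspace_V]
      by (intro ff_deriv_zero_arg[OF formal_F subspace_V offset(1)[OF graph]]) (auto simp: tens_def)
    from XY[OF x'_dual] have "eps_part R (Omega_ext B (dual_alg R) Y x') =
        eps_part R (ff_deriv (dual_alg R) (gF \<L>) (offset v) [X, x'])" by simp
    then show ?thesis
      by (simp add: Omega_ext_dual Omega_ext_zero[OF form] tens_low[OF x'] zero
          ff_deriv_dual_eps_pair[OF formal_F subspace_V offset[OF graph] X x'_dual])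
  qed
  moreover have "eps_part R g = (\<lambda>i. eps_part R X i + eps_part R Y i)"
    by (simp add: g_eq part_add)
  ultimately show ?thesis
    using tens_parts(2)[OF X] tens_parts(2)[OF Y] unfolding f_eq tangent_space_iff[OF graph] by blast
qed

lemma tangent_space_outside:
  assumes "h \<in> tangent_space B \<L> R f" "i \<ge> adim R"
  shows "h i = 0"
  using assms by (auto simp: tangent_space_def tens_def)

text \<open>Condition (c) is used twice: over \<open>R\<close> to divide \<open>f\<close> by
  \<open>z\<close>, and over \<open>R[\<epsilon>]\<close> to recognize the perturbed element as a
  point with the tangent space of \<open>f\<close>.\<close>

lemma l0_zmul_tangent:
  assumes cone: "cone_condition B \<L>" and tan: "tangent_to B (l0 a) \<L>"
    and f: "f \<in> points B \<L> R" and h: "h \<in> tangent_space B \<L> R f"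
  shows "l0 a \<circ> zmul \<circ> h \<in> tangent_space B \<L> R f"
proof -
  have c: "{f' \<in> points B \<L> S. tangent_space B \<L> S f' = tangent_space B \<L> S f} =
      {f' \<in> (\<lambda>g. zmul \<circ> g) ` tangent_space B \<L> S f. reduce S f' = base_pt \<L>}"
    if "local_alg S" "f \<in> points B \<L> S" for S
    using cone that unfolding cone_condition_def Let_def by blast
  \<comment> \<open>The point \<open>f\<close> trivially has its own tangent space, so (c) places it
    in \<open>zL\<close>.\<close>
  have "f \<in> {f' \<in> (\<lambda>g. zmul \<circ> g) ` tangent_space B \<L> R f. reduce R f' = base_pt \<L>}"
    using c[OF local f] f by blast
  then obtain f' where f': "f' \<in> tangent_space B \<L> R f" "f = zmul \<circ> f'" and red: "reduce R f = base_pt \<L>"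
    by blast
  define g where "g = dual_join R f' h"
  have "g \<in> tangent_space B \<L> (dual_alg R) f"
    unfolding g_def by (rule tangent_space_dual_join[OF f f'(1) h])
  \<comment> \<open>Reduction ignores the \<open>\<epsilon>\<close>-part, and the low part of
    \<open>zmul \<circ> g\<close> is \<open>f\<close>.\<close>
  moreover have "reduce (dual_alg R) (zmul \<circ> g) = base_pt \<L>"
    using red by (simp add: f'(2) g_def reduce_dual) (simp add: reduce_def low_part_def dual_join_def)
  ultimately have "zmul \<circ> g \<in> points B \<L> (dual_alg R) \<and>
      tangent_space B \<L> (dual_alg R) (zmul \<circ> g) = tangent_space B \<L> (dual_alg R) f"
    using c[OF local_alg_dual points_dual[OF f]] by blast
  then have "l0 a \<circ> (zmul \<circ> g) \<in> tangent_space B \<L> (dual_alg R) f"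
    using tan local_alg_dual unfolding tangent_to_def by metis
  from tangent_space_eps_part[OF f this] show ?thesis
  proof (rule back_subst[of "\<lambda>h. h \<in> tangent_space B \<L> R f"])
    \<comment> \<open>From index \<open>adim R\<close> on the left side is 0 by definition, and the
      right side is 0 because \<open>h\<close> vanishes there and both operators fix 0.\<close>
    show "eps_part R (l0 a \<circ> (zmul \<circ> g)) = l0 a \<circ> zmul \<circ> h"
      using tangent_space_outside[OF h]
      by (auto simp: fun_eq_iff eps_part_def g_def dual_join_def zmul_zero l0_zero)
  qed
qed

end

theorem theorem6:
  fixes B :: "complex^'n \<Rightarrow> complex^'n \<Rightarrow> complex"
    and \<L> :: "'n::finite germ"
    and a :: "(complex^'n^'n) fls"
    and m :: nat
  assumes "nondeg_sym_bilinear B"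
    and "lagrangian_germ B \<L>"
    and "cone_condition B \<L>"
    and "series_adj B (negz a) + a = 0"
    and "tangent_to B (l0 a) \<L>"
    and "m \<ge> 1"
  shows "tangent_to B (lm a m) \<L>"
  unfolding tangent_to_def
proof (intro allI impI)
  fix R f assume R: "local_alg R" and f: "f \<in> points B \<L> R"
  interpret germ_over_algebra R B \<L>
    using R assms(1,2)
    by (intro germ_over_algebra.intro local_algebra.intro germ_over_algebra_axioms.intro)
  \<comment> \<open>The tangent space at \<open>f\<close> stays fixed: \<open>k = 0\<close> is the
    tangency of \<open>l\<^sub>0\<close>, and each further step applies \<open>l\<^sub>0 z\<close>,
    under which the space is stable.\<close>
  have "((l0 a \<circ> zmul) ^^ k) \<circ> l0 a \<circ> f \<in> tangent_space B \<L> R f" for k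
  proof (induction k)
    case 0
    then show ?case using assms(5) R f by (simp add: tangent_to_def o_def)
  next
    case (Suc k)
    from l0_zmul_tangent[OF assms(3,5) f Suc] show ?case by (simp add: o_def)
  qed
  then show "lm a m \<circ> f \<in> tangent_space B \<L> R f" by (simp add: lm_def)
qed

end
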